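(* Let $m,c$ be fixed positive integers. For each $n\ge1$ let $\xi_n$ be the number of non-zero-blocks of a $(c,m)$-colored $B_n$-partition chosen uniformly at random, and let $E_n$ and $V_n$ be the expectation and variance of $\xi_n$. Then $(\xi_n-E_n)/\sqrt{V_n}$ converges in distribution to the standard normal distribution as $n\to\infty$.
   Context: Let $n,m,c$ be positive integers, let $C_1$ be a list of $c$ colors and $C_2$ a list of $m$ colors. A $(c,m)$-colored $B_n$-partition is a set partition $\pi$ of $[n]\cup\{0\}$ together with a coloring of the elements of $[n]$ defined as follows. For $x\in[n]\cup\{0\}$ let $b_x$ be the block of $\pi$ containing $x$. The block $b_0$ is called the zero-block, and every other block is a non-zero-block. Each $x\in[n]$ receives a color according to these rules: if $x=\min b_x$, then $x$ gets the first color of $C_2$; if $x\ne\min b_x$ and $x\in b_0$, then $x$ gets an arbitrary color from $C_1$; if $x\ne \min b_x$ and $x\notin b_0$, then $x$ gets an arbitrary color from $C_2$. Two such objects are equal exactly when they have the same underlying partition and the same coloring. *)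

theory Defs
  imports "HOL-Probability.Probability" "HOL-Library.Disjoint_Sets"
begin

text \<open>Colors are encoded as natural numbers: the list C1 of c colors is 0..<c, the list
  C2 of m colors is 0..<m, and the first color of C2 is 0. A colored B_n-partition is a pair
  (P, col) of a set partition P of {0..n} and a coloring col of {1..n} (extensional, i.e.
  col x = undefined outside {1..n}).\<close>

definition Bpart :: "nat \<Rightarrow> nat \<Rightarrow> nat \<Rightarrow> (nat set set \<times> (nat \<Rightarrow> nat)) set" where
  "Bpart c m n = {(P, col). partition_on {0..n} P \<and> col \<in> extensional {1..n} \<and>
     (\<forall>b\<in>P. \<forall>x\<in>b. 1 \<le> x \<longrightarrow>
        (x = Min b \<longrightarrow> col x = 0) \<and>
        (x \<noteq> Min b \<and> 0 \<in> b \<longrightarrow> col x < c) \<and>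
        (x \<noteq> Min b \<and> 0 \<notin> b \<longrightarrow> col x < m))}"

definition nonzero_blocks :: "nat set set \<times> (nat \<Rightarrow> nat) \<Rightarrow> nat" where
  "nonzero_blocks \<pi> = card {b \<in> fst \<pi>. 0 \<notin> b}"

definition xi_pmf :: "nat \<Rightarrow> nat \<Rightarrow> nat \<Rightarrow> real pmf" where
  "xi_pmf c m n = map_pmf (\<lambda>\<pi>. real (nonzero_blocks \<pi>)) (pmf_of_set (Bpart c m n))"

definition E_xi :: "nat \<Rightarrow> nat \<Rightarrow> nat \<Rightarrow> real" where
  "E_xi c m n = measure_pmf.expectation (xi_pmf c m n) (\<lambda>x. x)"

definition V_xi :: "nat \<Rightarrow> nat \<Rightarrow> nat \<Rightarrow> real" where
  "V_xi c m n = measure_pmf.variance (xi_pmf c m n) (\<lambda>x. x)"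

end

theory Submission
  imports Defs "HOL-Computational_Algebra.Polynomial"
begin

text \<open>
  Removing the largest element shows that the generating polynomials \<open>P_n\<close> of the number of
  non-zero-blocks satisfy \<open>P_{n+1} = (x + c) P_n + m x P_n'\<close>. By Rolle-type sign alternation at the
  roots of \<open>P_n\<close> all roots of \<open>P_{n+1}\<close> are real, negative and simple (Harper's method), so \<open>\<xi>_n\<close>
  is distributed as a sum of independent Bernoulli variables, and the central limit theorem holds
  as soon as \<open>V_n\<close> tends to infinity.

  For the variance, Dobinski's formula \<open>\<Sum>j. (m j + c)^n / (m^j j!) = exp (1/m) P_n 1\<close> identifies
  \<open>V_n + 1/m\<close> with the variance of the distribution on the naturals proportional to
  \<open>(m j + c)^n / (m^j j!)\<close>. Its mode \<open>J\<close> is at least of order \<open>n^(2/3)\<close>, which makes these weights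
  almost constant on \<open>{J..J + K}\<close> for every fixed \<open>K\<close>; hence the largest point mass tends to
  \<open>0\<close>, and the variance tends to infinity.
\<close>

section \<open>Adding a largest element to a colored partition\<close>

text \<open>The case \<open>b = {}\<close> stands for opening a new singleton block:
  \<open>{}\<close> is never in \<open>P\<close>, so nothing is then removed.\<close>

lemma partition_on_insert_into_block:
  assumes P: "partition_on A P" and a: "a \<notin> A" and b: "b \<in> insert {} P"
  shows "partition_on (insert a A) (insert (insert a b) (P - {b}))"
proof (rule partition_onI)
  show "\<Union> (insert (insert a b) (P - {b})) = insert a A"
    using partition_onD1[OF P] b by auto
  show "{} \<notin> insert (insert a b) (P - {b})"
    using partition_onD3[OF P] by auto
  have "disjnt (insert a b) q" if "q \<in> P - {b}" for q
    using that partition_onD1[OF P] partition_onD2[OF P] a b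
    by (auto simp: disjnt_def disjoint_def)
  moreover have "disjnt p q" if "p \<in> P" "q \<in> P" "p \<noteq> q" for p q
    using that partition_onD2[OF P] by (auto simp: disjnt_def disjoint_def)
  ultimately show "disjnt p q" if "p \<in> insert (insert a b) (P - {b})"
      "q \<in> insert (insert a b) (P - {b})" "p \<noteq> q" for p q
    using that by (metis Diff_iff disjnt_sym insertE)
qed

lemma partition_on_remove_element:
  assumes P: "partition_on (insert a A) P" and a: "a \<notin> A" and B: "B \<in> P" "a \<in> B"
  shows "partition_on A (insert (B - {a}) (P - {B}) - {{}})"
proof (rule partition_onI)
  have notin: "a \<notin> q" if "q \<in> P - {B}" for q
    using that B partition_onD2[OF P] by (auto simp: disjoint_def)
  show "\<Union> (insert (B - {a}) (P - {B}) - {{}}) = A"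
  proof -
    have "\<Union> (insert (B - {a}) (P - {B}) - {{}}) = (B - {a}) \<union> \<Union> (P - {B})" by blast
    also have "\<dots> = (B \<union> \<Union> (P - {B})) - {a}" using notin by blast
    also have "B \<union> \<Union> (P - {B}) = insert a A" using partition_onD1[OF P] B(1) by blast
    finally show ?thesis using a by blast
  qed
  show "{} \<notin> insert (B - {a}) (P - {B}) - {{}}"
    by auto
  have "disjnt (B - {a}) q" if "q \<in> P - {B}" for q
    using that partition_onD2[OF P] B by (auto simp: disjnt_def disjoint_def)
  moreover have "disjnt p q" if "p \<in> P" "q \<in> P" "p \<noteq> q" for p q
    using that partition_onD2[OF P] by (auto simp: disjnt_def disjoint_def)
  ultimately show "disjnt p q" if "p \<in> insert (B - {a}) (P - {B}) - {{}}"
      "q \<in> insert (B - {a}) (P - {B}) - {{}}" "p \<noteq> q" for p q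
    using that by (metis Diff_iff disjnt_sym insertE)
qed

section \<open>Colored partitions with a new largest element\<close>

definition valid_colors :: "nat \<Rightarrow> nat \<Rightarrow> (nat \<Rightarrow> nat) \<Rightarrow> nat set \<Rightarrow> bool" where
  "valid_colors c m col b \<longleftrightarrow> (\<forall>x\<in>b. 1 \<le> x \<longrightarrow>
     (x = Min b \<longrightarrow> col x = 0) \<and>
     (x \<noteq> Min b \<and> 0 \<in> b \<longrightarrow> col x < c) \<and>
     (x \<noteq> Min b \<and> 0 \<notin> b \<longrightarrow> col x < m))"

text \<open>The number of colors available to a new maximal element that joins the block \<open>b\<close>,
  where the empty block stands for opening a new one.\<close>

definition color_count :: "nat \<Rightarrow> nat \<Rightarrow> nat set \<Rightarrow> nat" where
  "color_count c m b = (if b = {} then 1 else if 0 \<in> b then c else m)"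

definition join_block ::
  "nat \<Rightarrow> (nat set set \<times> (nat \<Rightarrow> nat)) \<times> nat set \<times> nat \<Rightarrow> nat set set \<times> (nat \<Rightarrow> nat)" where
  "join_block a = (\<lambda>((P, col), b, x). (insert (insert a b) (P - {b}), col(a := x)))"

lemma Bpart_iff:
  "(P, col) \<in> Bpart c m n \<longleftrightarrow> partition_on {0..n} P \<and> col \<in> extensional {1..n} \<and>
     (\<forall>b\<in>P. valid_colors c m col b)"
  by (simp add: Bpart_def valid_colors_def)

text \<open>A new maximum leaves the minimum of a nonempty \<open>b\<close> unchanged, so the old
  conditions survive and only the new color is free. For \<open>b = {}\<close> the new element is
  its own minimum and must take color 0, whence the single choice.\<close>

lemma valid_colors_insert_iff:
  assumes "b \<subseteq> {0..n}"
  shows "valid_colors c m (col(Suc n := x)) (insert (Suc n) b) \<longleftrightarrow>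
         valid_colors c m col b \<and> x < color_count c m b"
proof (cases "b = {}")
  case True
  then show ?thesis by (auto simp: valid_colors_def color_count_def)
next
  case False
  have fin: "finite b" using assms finite_subset by blast
  have "Min b \<in> b" using fin False by simp
  then have "Min b \<le> n" using assms by auto
  then have Min: "Min (insert (Suc n) b) = Min b"
    by (subst Min_insert[OF fin False], intro min_absorb2) simp
  have ne: "Suc n \<noteq> Min b" "Suc n \<notin> b"
    using assms \<open>Min b \<le> n\<close> by (metis Suc_n_not_le_n, auto)
  have upd: "(col(Suc n := x)) y = col y" if "y \<in> b" for y using that ne by auto
  define M where "M = Min b"
  have "Suc n \<noteq> M" using ne by (simp only: M_def not_False_eq_True)
  then show ?thesis
    using False upd unfolding valid_colors_def Min color_count_def M_def[symmetric]
    by simp blast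
qed

lemma valid_colors_upd: "a \<notin> b \<Longrightarrow> valid_colors c m (col(a := x)) b = valid_colors c m col b"
  unfolding valid_colors_def by (intro ball_cong refl) auto

lemma finite_Bpart: "finite (Bpart c m n)"
proof (rule finite_subset)
  show "Bpart c m n \<subseteq> {P. partition_on {0..n} P} \<times> (\<Pi>\<^sub>E x\<in>{1..n}. {0..c+m})"
  proof clarify
    fix P col assume *: "(P, col) \<in> Bpart c m n"
    then have P: "partition_on {0..n} P" and ext: "col \<in> extensional {1..n}"
      and v: "\<And>b. b \<in> P \<Longrightarrow> valid_colors c m col b"
      by (auto simp: Bpart_iff)
    have "col x \<in> {0..c+m}" if x: "x \<in> {1..n}" for x
    proof -
      obtain b where "b \<in> P" "x \<in> b" using x partition_onD1[OF P] by (metis UnionE atLeastAtMost_iff le0)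
      then show ?thesis using v[of b] x unfolding valid_colors_def by fastforce
    qed
    then show "P \<in> {P. partition_on {0..n} P} \<and> col \<in> (\<Pi>\<^sub>E x\<in>{1..n}. {0..c+m})"
      using P ext by (auto simp: PiE_def)
  qed
  show "finite ({P. partition_on {0..n} P} \<times> (\<Pi>\<^sub>E x\<in>{1..n}. {0..c+m}))"
    by (intro finite_cartesian_product finitely_many_partition_on finite_PiE) auto
qed

text \<open>Deleting the largest element inverts \<open>join_block\<close>: it recovers the color
  and the block that was joined, which is \<open>{}\<close> if the element was alone.\<close>

lemma bij_betw_join_block:
  "bij_betw (join_block (Suc n))
     (SIGMA \<pi>:Bpart c m n. SIGMA b:insert {} (fst \<pi>). {..<color_count c m b})
     (Bpart c m (Suc n))"
  (is "bij_betw ?f ?I _")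
proof -
  let ?a = "Suc n"
  have sub: "b \<subseteq> {0..n}" if "partition_on {0..n} P" "b \<in> insert {} P" for b P
    using that partition_onD1 by fastforce
  show ?thesis unfolding bij_betw_def
  proof (intro conjI subset_antisym)
    show "inj_on ?f ?I"
    proof (rule inj_onI)
      fix u v assume u: "u \<in> ?I" and v: "v \<in> ?I" and eq: "?f u = ?f v"
      obtain P col b x where u': "u = ((P, col), b, x)" by (metis surj_pair)
      obtain Q col' b' x' where v': "v = ((Q, col'), b', x')" by (metis surj_pair)
      have P: "partition_on {0..n} P" "b \<in> insert {} P" "col \<in> extensional {1..n}"
        using u by (auto simp: u' Bpart_iff)
      have Q: "partition_on {0..n} Q" "b' \<in> insert {} Q" "col' \<in> extensional {1..n}"
        using v by (auto simp: v' Bpart_iff)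
      have eq1: "insert (insert ?a b) (P - {b}) = insert (insert ?a b') (Q - {b'})"
        and eq2: "col(?a := x) = col'(?a := x')"
        using eq by (auto simp: u' v' join_block_def)
      have aP: "?a \<notin> p" if "p \<in> insert {} P" for p using sub[OF P(1) that] by auto
      have aQ: "?a \<notin> q" if "q \<in> insert {} Q" for q using sub[OF Q(1) that] by auto
      have x: "x = x'" using eq2 by (metis fun_upd_same)
      have "col y = col' y" for y
        using fun_cong[OF eq2, of y] P(3) Q(3) by (cases "y = ?a") (auto simp: extensional_def)
      then have col: "col = col'" by blast
      have "insert ?a b \<in> insert (insert ?a b') (Q - {b'})" using eq1 by blast
      then have "insert ?a b = insert ?a b'" using aQ by blast
      then have b: "b = b'" using aP[OF P(2)] aQ[OF Q(2)] by (metis insert_ident)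
      \<comment> \<open>The blocks other than \<open>b\<close> are those avoiding the new element,
        so they can be read off from the image.\<close>
      have "P - {b} = {p \<in> insert (insert ?a b) (P - {b}). ?a \<notin> p}" using aP by auto
      also have "\<dots> = {p \<in> insert (insert ?a b') (Q - {b'}). ?a \<notin> p}" by (simp only: eq1)
      also have "\<dots> = Q - {b}" using aQ b by auto
      finally have "P - {b} = Q - {b}" .
      then have "P = Q"
        using P(2) Q(2) b partition_onD3[OF P(1)] partition_onD3[OF Q(1)] by (cases "b = {}") auto
      then show "u = v" using x col b u' v' by simp
    qed
    show "?f ` ?I \<subseteq> Bpart c m (Suc n)"
    proof (rule image_subsetI)
      fix u assume u: "u \<in> ?I"
      obtain P col b x where u': "u = ((P, col), b, x)" by (metis surj_pair)
      have P: "(P, col) \<in> Bpart c m n" and b: "b \<in> insert {} (fst (P, col))"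
        and x: "x < color_count c m b"
        using u by (auto simp: u')
      have P': "partition_on {0..n} P" "col \<in> extensional {1..n}"
          "\<And>b. b \<in> P \<Longrightarrow> valid_colors c m col b"
        using P by (auto simp: Bpart_iff)
      have b': "b \<in> insert {} P" using b by simp
      have "valid_colors c m col b" using P'(3) b' by (auto simp: valid_colors_def)
      then have v: "valid_colors c m (col(?a := x)) (insert ?a b)"
        using x valid_colors_insert_iff[OF sub[OF P'(1) b']] by blast
      have w: "valid_colors c m (col(?a := x)) p" if "p \<in> P" for p
        using P'(3)[OF that] sub[OF P'(1), of p] that by (subst valid_colors_upd) auto
      have "partition_on {0..Suc n} (insert (insert ?a b) (P - {b}))"
        unfolding atLeast0_atMost_Suc by (rule partition_on_insert_into_block[OF P'(1) _ b']) auto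
      moreover have "col(?a := x) \<in> extensional {1..Suc n}"
        using P'(2) by (auto simp: extensional_def)
      ultimately show "?f u \<in> Bpart c m (Suc n)"
        using v w by (auto simp: u' join_block_def Bpart_iff)
    qed
    show "Bpart c m (Suc n) \<subseteq> ?f ` ?I"
    proof
      fix \<pi> assume "\<pi> \<in> Bpart c m (Suc n)"
      moreover obtain P col where \<pi>: "\<pi> = (P, col)" by (metis surj_pair)
      ultimately have P: "partition_on (insert ?a {0..n}) P" "col \<in> extensional {1..Suc n}"
          "\<And>b. b \<in> P \<Longrightarrow> valid_colors c m col b"
        by (auto simp: Bpart_iff atLeast0_atMost_Suc)
      obtain B where B: "B \<in> P" "?a \<in> B" using partition_onD1[OF P(1)] by auto
      define b where "b = B - {?a}"
      define Q where "Q = insert b (P - {B}) - {{}}"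
      \<comment> \<open>Resetting the color to \<open>undefined\<close> makes the coloring
        extensional on \<open>{1..n}\<close> again.\<close>
      define col' where "col' = col(?a := undefined)"
      have Q: "partition_on {0..n} Q"
        unfolding Q_def b_def by (rule partition_on_remove_element[OF P(1) _ B]) auto
      have b: "b \<in> insert {} Q" by (auto simp: Q_def)
      have aP: "?a \<notin> q" if "q \<in> P - {B}" for q
        using that B partition_onD2[OF P(1)] by (auto simp: disjoint_def)
      have Bb: "B = insert ?a b" using B by (auto simp: b_def)
      have cc: "col'(?a := col ?a) = col" by (simp add: col'_def)
      have vb: "valid_colors c m col' b" "col ?a < color_count c m b"
        using P(3)[OF B(1)] valid_colors_insert_iff[OF sub[OF Q b], of c m col' "col ?a"]
        by (auto simp: cc Bb)
      have "valid_colors c m col' q" if "q \<in> Q" for q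
      proof (cases "q = b")
        case False
        then have "q \<in> P - {B}" using that by (auto simp: Q_def)
        then show ?thesis using P(3) aP unfolding col'_def by (subst valid_colors_upd) auto
      qed (use vb in simp)
      moreover have "col' \<in> extensional {1..n}"
        using P(2) by (auto simp: extensional_def col'_def)
      ultimately have mem: "(Q, col') \<in> Bpart c m n" using Q by (simp add: Bpart_iff)
      \<comment> \<open>Otherwise removing \<open>b\<close> from \<open>Q\<close> would also remove
        an old block of \<open>P\<close>, and joining would not give \<open>P\<close> back.\<close>
      have "b \<notin> P - {B}"
      proof
        assume *: "b \<in> P - {B}"
        then have "b \<inter> B = {}" using B partition_onD2[OF P(1)] by (auto simp: disjoint_def)
        then have "b = {}" by (auto simp: b_def)
        then show False using * partition_onD3[OF P(1)] by auto
      qed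
      then have "insert (insert ?a b) (Q - {b}) = P"
        using B partition_onD3[OF P(1)] by (auto simp: Q_def Bb[symmetric])
      then have "\<pi> = ?f ((Q, col'), b, col ?a)" by (simp add: join_block_def cc \<pi>)
      then show "\<pi> \<in> ?f ` ?I" using mem b vb by (intro image_eqI[where x="((Q, col'), b, col ?a)"]) auto
    qed
  qed
qed

lemma nonzero_blocks_join_block:
  assumes P: "partition_on {0..n} P" and b: "b \<in> insert {} P"
  shows "nonzero_blocks (join_block (Suc n) ((P, col), b, x)) =
         (if b = {} then Suc (nonzero_blocks (P, col)) else nonzero_blocks (P, col))"
proof -
  let ?N = "{p \<in> P. 0 \<notin> p}"
  have fin: "finite P" using P finite_elements by blast
  have a: "Suc n \<notin> p" if "p \<in> P" for p
    using that partition_onD1[OF P] by (metis UnionI atLeastAtMost_iff not_less_eq_eq order_refl)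
  have "{} \<notin> P" using partition_onD3[OF P] .
  have eq: "{p \<in> insert (insert (Suc n) b) (P - {b}). 0 \<notin> p} =
        (if 0 \<in> b then ?N else insert (insert (Suc n) b) (?N - {b}))"
    by auto
  have "card (insert (insert (Suc n) b) (?N - {b})) = Suc (card (?N - {b}))"
    using fin a by (subst card_insert_disjoint) auto
  moreover have "card (?N - {b}) = card ?N - 1" "card ?N > 0" if "b \<in> P" "0 \<notin> b"
    using that fin by (auto simp: card_gt_0_iff card_Diff_singleton)
  moreover have "nonzero_blocks (join_block (Suc n) ((P, col), b, x)) =
      card {p \<in> insert (insert (Suc n) b) (P - {b}). 0 \<notin> p}"
    by (simp add: nonzero_blocks_def join_block_def)
  moreover have "?N - {{}} = ?N" using \<open>{} \<notin> P\<close> by auto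
  ultimately show ?thesis using b \<open>{} \<notin> P\<close> unfolding eq by (auto simp: nonzero_blocks_def)
qed

text \<open>Exactly one block contains 0 and offers \<open>c\<close> colors; every other block
  offers \<open>m\<close>.\<close>

lemma sum_color_count:
  assumes P: "partition_on {0..n} P"
  shows "(\<Sum>b\<in>P. color_count c m b) = c + m * nonzero_blocks (P, col)"
proof -
  have fin: "finite P" using P finite_elements by blast
  have "{} \<notin> P" using partition_onD3[OF P] .
  obtain z where z: "z \<in> P" "0 \<in> z"
    using partition_onD1[OF P] by (metis UnionE atLeastAtMost_iff le0)
  have uniq: "p = z" if "p \<in> P" "0 \<in> p" for p
    using that z partition_onD2[OF P] by (auto simp: disjoint_def)
  have "{p \<in> P. 0 \<notin> p} = P - {z}" using z uniq by blast
  moreover have "(\<Sum>b\<in>P. color_count c m b) = color_count c m z + (\<Sum>b\<in>P - {z}. color_count c m b)"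
    using fin z by (simp add: sum.remove)
  moreover have "(\<Sum>b\<in>P - {z}. color_count c m b) = (\<Sum>b\<in>P - {z}. m)"
    using uniq \<open>{} \<notin> P\<close> by (intro sum.cong) (auto simp: color_count_def)
  ultimately show ?thesis using z by (auto simp: nonzero_blocks_def color_count_def)
qed

section \<open>Sums over colored partitions and their recurrence\<close>

text \<open>The value type is general so that one notion serves real moments, generating polynomials
  (with \<open>monom 1\<close> for \<open>f\<close>) and complex exponentials.\<close>

definition Bsum :: "nat \<Rightarrow> nat \<Rightarrow> nat \<Rightarrow> (nat \<Rightarrow> 'a::comm_semiring_1) \<Rightarrow> 'a" where
  "Bsum c m n f = (\<Sum>\<pi>\<in>Bpart c m n. f (nonzero_blocks \<pi>))"

text \<open>The new element either opens a block, raising the count by one, or joins an old one, for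
  which \<open>sum_color_count\<close> leaves \<open>c + m * k\<close> possibilities.\<close>

lemma Bsum_Suc:
  "Bsum c m (Suc n) f = Bsum c m n (\<lambda>k. f (Suc k) + of_nat (c + m * k) * f k)"
proof -
  let ?J = "\<lambda>\<pi>. SIGMA b:insert {} (fst \<pi>). {..<color_count c m b}"
  have "Bsum c m (Suc n) f = (\<Sum>u\<in>Sigma (Bpart c m n) ?J. f (nonzero_blocks (join_block (Suc n) u)))"
    unfolding Bsum_def by (rule sum.reindex_bij_betw[OF bij_betw_join_block, symmetric])
  also have "\<dots> = (\<Sum>\<pi>\<in>Bpart c m n. \<Sum>v\<in>?J \<pi>. f (nonzero_blocks (join_block (Suc n) (\<pi>, v))))"
    by (subst sum.Sigma)
       (auto simp: finite_Bpart Bpart_iff intro!: finite_elements[of "{0..n}"])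
  also have "\<dots> = Bsum c m n (\<lambda>k. f (Suc k) + of_nat (c + m * k) * f k)"
    unfolding Bsum_def
  proof (rule sum.cong[OF refl])
    fix \<pi> assume "\<pi> \<in> Bpart c m n"
    moreover obtain P col where \<pi>: "\<pi> = (P, col)" by (metis surj_pair)
    ultimately have P: "partition_on {0..n} P" by (simp add: Bpart_iff)
    have fin: "finite P" using P finite_elements by blast
    have ne: "{} \<notin> P" using partition_onD3[OF P] .
    let ?k = "nonzero_blocks \<pi>"
    have "(\<Sum>v\<in>?J \<pi>. f (nonzero_blocks (join_block (Suc n) (\<pi>, v)))) =
      (\<Sum>b\<in>insert {} P. \<Sum>x<color_count c m b. f (nonzero_blocks (join_block (Suc n) (\<pi>, b, x))))"
      using fin by (subst sum.Sigma) (auto simp: \<pi>)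
    also have "\<dots> = (\<Sum>b\<in>insert {} P. of_nat (color_count c m b) * f (if b = {} then Suc ?k else ?k))"
      by (intro sum.cong refl) (simp add: nonzero_blocks_join_block[OF P] \<pi>)
    also have "\<dots> = f (Suc ?k) + (\<Sum>b\<in>P. of_nat (color_count c m b) * f (if b = {} then Suc ?k else ?k))"
      using fin ne by (simp add: color_count_def)
    also have "(\<Sum>b\<in>P. of_nat (color_count c m b) * f (if b = {} then Suc ?k else ?k)) =
      (\<Sum>b\<in>P. of_nat (color_count c m b) * f ?k)"
      using ne by (intro sum.cong) auto
    also have "\<dots> = of_nat (c + m * ?k) * f ?k"
      by (simp only: sum_distrib_right[symmetric] of_nat_sum[symmetric] sum_color_count[OF P, where col=col] \<pi>)
    finally show "(\<Sum>v\<in>?J \<pi>. f (nonzero_blocks (join_block (Suc n) (\<pi>, v)))) =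
      f (Suc ?k) + of_nat (c + m * ?k) * f ?k" .
  qed
  finally show ?thesis .
qed

lemma Bsum_0: "Bsum c m 0 f = f 0"
proof -
  have "partition_on {0..0} P \<longleftrightarrow> P = {{0::nat}}" for P
  proof
    assume *: "partition_on {0..0::nat} P"
    then have "\<Union>P = {0}" "{} \<notin> P" using partition_onD1 partition_onD3 by fastforce+
    then have "p = {0}" if "p \<in> P" for p using that by (metis Union_upper subset_singletonD)
    moreover have "P \<noteq> {}" using \<open>\<Union>P = {0}\<close> by auto
    ultimately show "P = {{0}}" by blast
  next
    assume "P = {{0}}"
    then show "partition_on {0..0} P" by (auto simp: partition_on_def)
  qed
  moreover have "valid_colors c m col {0}" for col by (simp add: valid_colors_def)
  moreover have "extensional {1..0::nat} = {\<lambda>x. undefined :: nat}" by simp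
  ultimately have "(P, col) \<in> Bpart c m 0 \<longleftrightarrow> P = {{0}} \<and> col = (\<lambda>x. undefined)" for P col
    unfolding Bpart_iff by (metis singletonD singletonI)
  then have "Bpart c m 0 = {({{0}}, \<lambda>x. undefined)}" by auto
  moreover have "nonzero_blocks ({{0}}, col) = 0" for col
    by (auto simp: nonzero_blocks_def card_eq_0_iff)
  ultimately show ?thesis by (simp add: Bsum_def)
qed

section \<open>Real-rootedness\<close>

lemma degree_prod_linear: "degree (\<Prod>i<N. [:b i, 1:] :: 'a::idom poly) = N"
  by (subst degree_prod_sum_eq) auto

lemma coeff_prod_linear: "coeff (\<Prod>i<N. [:b i, 1:] :: 'a::idom poly) N = 1"
proof -
  have "lead_coeff (\<Prod>i<N. [:b i, 1:] :: 'a poly) = (\<Prod>i<N. lead_coeff [:b i, 1:])"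
    by (rule lead_coeff_prod)
  then show ?thesis by (simp add: degree_prod_linear)
qed

text \<open>The intermediate value theorem puts a root into each of \<open>N\<close> disjoint
  intervals; a polynomial of degree at most \<open>N\<close> is determined by \<open>N\<close>
  distinct roots and its coefficient at \<open>N\<close>. Evaluating at \<open>- s i\<close> makes
  the \<open>b i\<close> increase with \<open>i\<close>.\<close>

lemma monic_poly_splits_of_alternating_signs:
  fixes Q :: "real poly" and s :: "nat \<Rightarrow> real"
  assumes Q: "degree Q \<le> N" "coeff Q N = 1"
    and s: "\<And>i. i < N \<Longrightarrow> s i < s (Suc i)"
    and sgn: "\<And>i. i \<le> N \<Longrightarrow> (-1) ^ i * poly Q (- s i) > 0"
  obtains b where "Q = (\<Prod>i<N. [:b i, 1:])" "\<And>i. i < N \<Longrightarrow> s i < b i \<and> b i < s (Suc i)"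
proof -
  have "\<exists>x. s i < x \<and> x < s (Suc i) \<and> poly Q (- x) = 0" if i: "i < N" for i
  proof -
    \<comment> \<open>The product of two consecutive sign conditions contains an odd power of -1, so
      \<open>Q\<close> changes sign between the two points.\<close>
    have "0 < ((-1) ^ i * poly Q (- s i)) * ((-1) ^ Suc i * poly Q (- s (Suc i)))"
      using i by (intro mult_pos_pos sgn) auto
    also have "\<dots> = - ((-1) ^ (2 * i) * (poly Q (- s (Suc i)) * poly Q (- s i)))"
      by (simp add: power_add mult_2)
    finally have "poly Q (- s (Suc i)) * poly Q (- s i) < 0" by simp
    then obtain x where "- s (Suc i) < x" "x < - s i" "poly Q x = 0"
      using poly_IVT[of "- s (Suc i)" "- s i" Q] s[OF i] by auto
    then show ?thesis by (intro exI[of _ "- x"]) auto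
  qed
  then obtain b where b: "\<And>i. i < N \<Longrightarrow> s i < b i \<and> b i < s (Suc i) \<and> poly Q (- b i) = 0"
    by metis
  have mono: "s i \<le> s j" if "i \<le> j" "j \<le> N" for i j
    using that
  proof (induction rule: dec_induct)
    case (step k)
    then show ?case using s[of k] by auto
  qed simp
  have less: "b i < b j" if "i < j" "j < N" for i j
    using b[of i] b[of j] mono[of "Suc i" j] that by auto
  have inj: "inj_on (\<lambda>i. - b i) {..<N}"
    by (intro inj_onI) (metis lessThan_iff less less_irrefl linorder_neqE_nat neg_equal_iff_equal)
  have "Q = (\<Prod>i<N. [:b i, 1:])"
  proof (rule poly_eqI_degree_lead_coeff[where n = N and A = "(\<lambda>i. - b i) ` {..<N}"])
    show "poly Q z = poly (\<Prod>i<N. [:b i, 1:]) z" if "z \<in> (\<lambda>i. - b i) ` {..<N}" for z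
      using that b by (auto simp: poly_prod intro!: prod_zero[symmetric])
  qed (use Q inj in \<open>auto simp: card_image degree_prod_linear coeff_prod_linear\<close>)
  then show ?thesis using b by (intro that) auto
qed

text \<open>Named after the r-Whitney numbers, the coefficients of the polynomials that this operator
  generates from \<open>1\<close>.\<close>

definition whitney_op :: "nat \<Rightarrow> nat \<Rightarrow> 'a::idom poly \<Rightarrow> 'a poly" where
  "whitney_op c m P = [:of_nat c, 1:] * P + [:0, of_nat m:] * pderiv P"

lemma whitney_op_coeff:
  fixes P :: "'a::idom poly"
  assumes "degree P \<le> n" "coeff P n = 1"
  shows "degree (whitney_op c m P) \<le> Suc n" "coeff (whitney_op c m P) (Suc n) = 1"
proof -
  have d: "degree (pderiv P) \<le> n"
    using assms by (auto intro!: degree_le simp: coeff_pderiv coeff_eq_0)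
  show "degree (whitney_op c m P) \<le> Suc n"
    unfolding whitney_op_def using assms d
    by (intro degree_add_le order_trans[OF degree_mult_le]) (auto simp: le_SucI)
  show "coeff (whitney_op c m P) (Suc n) = 1"
    using assms by (simp add: whitney_op_def coeff_pderiv coeff_eq_0)
qed

text \<open>The sign of the image is known at \<open>n + 2\<close> points: at 0 it is positive
  because \<open>c > 0\<close>; at a root \<open>- a j\<close> only the term with the derivative
  survives, and its sign alternates since the roots are simple; far to the left the leading term
  decides. Strict order of the roots is returned so that the step can be iterated.\<close>

lemma whitney_op_splits:
  fixes a :: "nat \<Rightarrow> real"
  assumes c: "c > 0" and m: "m > 0" and pos: "\<And>i. i < n \<Longrightarrow> a i > 0"
    and mono: "\<And>i j. i < j \<Longrightarrow> j < n \<Longrightarrow> a i < a j"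
  obtains b where "whitney_op c m (\<Prod>i<n. [:a i, 1:]) = (\<Prod>i<Suc n. [:b i, 1:])"
    "\<forall>i<Suc n. b i > 0" "\<forall>j<Suc n. \<forall>i<j. b i < b j"
proof -
  let ?P = "\<Prod>i<n. [:a i, 1:]"
  define Q where "Q = whitney_op c m ?P"
  have Q: "degree Q \<le> Suc n" "coeff Q (Suc n) = 1"
    unfolding Q_def by (rule whitney_op_coeff; simp add: degree_prod_linear coeff_prod_linear)+
  \<comment> \<open>Reflecting \<open>Q\<close> and normalizing it to be monic turns its behavior at
    minus infinity into positivity of \<open>R\<close> for large arguments.\<close>
  define R where "R = smult ((-1) ^ Suc n) (Q \<circ>\<^sub>p [:0, -1:])"
  have "degree Q = Suc n" using Q by (intro antisym le_degree) auto
  then have "lead_coeff R = 1"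
    using Q by (simp add: R_def lead_coeff_smult lead_coeff_comp power_mult_distrib[symmetric]
      flip: power_Suc)
  then obtain x0 where x0: "\<And>x. x \<ge> x0 \<Longrightarrow> poly R x \<ge> 1"
    using poly_pinfty_gt_lc[of R] by auto
  \<comment> \<open>The point \<open>- t\<close> lies to the left of all old roots; the entry 1
    keeps \<open>t\<close> positive also for \<open>n = 0\<close>.\<close>
  define t where "t = Max (insert x0 (insert 1 ((\<lambda>i. a i + 1) ` {..<n})))"
  have t: "t \<ge> x0" "t \<ge> 1" "\<And>i. i < n \<Longrightarrow> t \<ge> a i + 1"
    unfolding t_def by (intro Max_ge; auto)+
  \<comment> \<open>The test points are 0, then the \<open>n\<close> old roots with their index
    shifted by one, then \<open>t\<close>.\<close>
  define s where "s i = (if i = 0 then 0 else if i = Suc n then t else a (i - 1))" for i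
  have s: "s i < s (Suc i)" if "i < Suc n" for i
  proof (cases "i = n")
    case True
    show ?thesis using t(2) t(3)[of "i - 1"] True by (auto simp: s_def)
  next
    case False
    then show ?thesis using that pos mono[of "i - 1" i] by (auto simp: s_def)
  qed
  have sgn: "(-1) ^ i * poly Q (- s i) > 0" if "i \<le> Suc n" for i
  proof -
    have "i = 0 \<or> i = Suc n \<or> 0 < i \<and> i \<le> n" using that by linarith
    then consider "i = 0" | "i = Suc n" | "0 < i" "i \<le> n" by blast
    then show ?thesis
    proof cases
      case 1
      have "(\<Prod>i<n. a i) > 0" using pos by (intro prod_pos) auto
      then show ?thesis using 1 c by (simp add: s_def Q_def whitney_op_def poly_prod)
    next
      case 2
      then show ?thesis using x0[OF t(1)] by (simp add: s_def R_def poly_pcompose)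
    next
      case i: 3
      define j where "j = i - 1"
      have 3: "i = Suc j" "j < n" using i by (auto simp: j_def)
      \<comment> \<open>In the product rule only the summand that omits the factor vanishing at
        \<open>- a j\<close> survives.\<close>
      have "poly (pderiv ?P) (- a j) = (\<Sum>k<n. \<Prod>i\<in>{..<n} - {k}. a i - a j)"
        by (simp add: pderiv_prod poly_sum poly_prod pderiv_pCons)
      also have "\<dots> = (\<Sum>k<n. if k = j then \<Prod>i\<in>{..<n} - {j}. a i - a j else 0)"
        using 3 by (intro sum.cong) (auto intro!: prod_zero)
      also have "\<dots> = (\<Prod>i\<in>{..<n} - {j}. a i - a j)" using 3 by simp
      also have "{..<n} - {j} = {..<j} \<union> {j<..<n}" using 3 by auto
      also have "(\<Prod>i\<in>{..<j} \<union> {j<..<n}. a i - a j) =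
          (\<Prod>i<j. a i - a j) * (\<Prod>i\<in>{j<..<n}. a i - a j)"
        by (intro prod.union_disjoint) auto
      also have "(\<Prod>i<j. a i - a j) = (\<Prod>i<j. (-1) * (a j - a i))" by simp
      also have "\<dots> = (-1) ^ j * (\<Prod>i<j. a j - a i)" by (subst prod.distrib) simp
      finally have eq: "poly (pderiv ?P) (- a j) =
        (-1) ^ j * (\<Prod>i<j. a j - a i) * (\<Prod>i\<in>{j<..<n}. a i - a j)" .
      have "poly ?P (- a j) = 0" using 3 by (auto simp: poly_prod intro!: prod_zero)
      then have "poly Q (- a j) = - (real m * a j * poly (pderiv ?P) (- a j))"
        by (simp add: Q_def whitney_op_def)
      then have "(-1) ^ i * poly Q (- s i) =
         ((-1) ^ (j + j)) * (real m * a j * (\<Prod>i<j. a j - a i) * (\<Prod>i\<in>{j<..<n}. a i - a j))"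
        using 3 by (simp add: s_def eq power_add)
      also have "\<dots> = real m * a j * (\<Prod>i<j. a j - a i) * (\<Prod>i\<in>{j<..<n}. a i - a j)"
        by (simp flip: mult_2)
      also have "\<dots> > 0" using m pos mono 3 by (intro mult_pos_pos prod_pos) auto
      finally show ?thesis .
    qed
  qed
  obtain b where b: "Q = (\<Prod>i<Suc n. [:b i, 1:])" "\<And>i. i < Suc n \<Longrightarrow> s i < b i \<and> b i < s (Suc i)"
    using monic_poly_splits_of_alternating_signs[OF Q s sgn] by blast
  have smono: "s i \<le> s j" if "i \<le> j" "j \<le> Suc n" for i j
    using that
  proof (induction rule: dec_induct)
    case (step k)
    then show ?case using s[of k] by auto
  qed simp
  show ?thesis
  proof (rule that)
    show "whitney_op c m ?P = (\<Prod>i<Suc n. [:b i, 1:])" using b(1) by (simp only: Q_def)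
    have "b i > 0" if "i < Suc n" for i
      using b(2)[OF that] smono[of 0 i] that by (auto simp: s_def)
    then show "\<forall>i<Suc n. b i > 0" by blast
    have "b i < b j" if "i < j" "j < Suc n" for i j
      using b(2)[of i] b(2)[of j] smono[of "Suc i" j] that by auto
    then show "\<forall>j<Suc n. \<forall>i<j. b i < b j" by blast
  qed
qed

text \<open>These are logarithmic derivatives: P'/P is the sum of 1/(x + a_i), and P''/P is the
  square of that sum plus its derivative. With p_i = 1/(1 + a_i) they give the first two factorial
  moments of a sum of independent Bernoulli variables.\<close>

lemma poly_pderiv_prod_linear:
  fixes a :: "nat \<Rightarrow> real"
  assumes "\<And>i. i < n \<Longrightarrow> a i > 0"
  defines "P \<equiv> \<lambda>n. \<Prod>i<n. [:a i, 1:]"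
  shows "poly (pderiv (P n)) 1 = poly (P n) 1 * (\<Sum>i<n. 1 / (1 + a i))"
    and "poly (pderiv (pderiv (P n))) 1 =
      poly (P n) 1 * ((\<Sum>i<n. 1 / (1 + a i))\<^sup>2 - (\<Sum>i<n. (1 / (1 + a i))\<^sup>2))"
proof -
  have "poly (pderiv (P n)) 1 = poly (P n) 1 * (\<Sum>i<n. 1 / (1 + a i)) \<and>
    poly (pderiv (pderiv (P n))) 1 =
      poly (P n) 1 * ((\<Sum>i<n. 1 / (1 + a i))\<^sup>2 - (\<Sum>i<n. (1 / (1 + a i))\<^sup>2))"
    using assms(1)
  proof (induction n)
    case 0
    then show ?case by (simp add: P_def)
  next
    case (Suc n)
    have P: "P (Suc n) = P n * [:a n, 1:]" by (simp add: P_def mult.commute)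
    have an: "1 + a n \<noteq> 0" using Suc.prems[of n] by simp
    have l: "pderiv [:a n, 1:] = 1" by (simp add: pderiv_pCons)
    have D1: "pderiv (P (Suc n)) = [:a n, 1:] * pderiv (P n) + P n"
      by (simp add: P pderiv_mult l del: mult_pCons_left mult_pCons_right)
    then have D2: "pderiv (pderiv (P (Suc n))) = [:a n, 1:] * pderiv (pderiv (P n)) + 2 * pderiv (P n)"
      by (simp add: pderiv_mult pderiv_add l del: mult_pCons_left mult_pCons_right)
    have d1: "poly (pderiv (P (Suc n))) 1 = poly (P n) 1 + (1 + a n) * poly (pderiv (P n)) 1"
      by (simp add: D1 algebra_simps)
    have d2: "poly (pderiv (pderiv (P (Suc n)))) 1 =
        2 * poly (pderiv (P n)) 1 + (1 + a n) * poly (pderiv (pderiv (P n))) 1"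
      by (simp add: D2 algebra_simps)
    have d0: "poly (P (Suc n)) 1 = poly (P n) 1 * (1 + a n)" by (simp add: P algebra_simps)
    have IH: "poly (pderiv (P n)) 1 = poly (P n) 1 * (\<Sum>i<n. 1 / (1 + a i))"
      "poly (pderiv (pderiv (P n))) 1 =
        poly (P n) 1 * ((\<Sum>i<n. 1 / (1 + a i))\<^sup>2 - (\<Sum>i<n. (1 / (1 + a i))\<^sup>2))"
      using Suc by auto
    define q where "q = 1 / (1 + a n)"
    have q: "(1 + a n) * q = 1" using an by (simp add: q_def)
    have "X + (1 + a n) * (X * A) = X * (1 + a n) * (A + q)" for A X
    proof -
      have "X * (1 + a n) * (A + q) = (1 + a n) * (X * A) + X * ((1 + a n) * q)"
        by (simp add: algebra_simps)
      then show ?thesis by (simp add: q)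
    qed
    moreover have "2 * (X * A) + (1 + a n) * (X * (A\<^sup>2 - B)) =
        X * (1 + a n) * ((A + q)\<^sup>2 - (B + q\<^sup>2))" for A B X
    proof -
      have "X * (1 + a n) * ((A + q)\<^sup>2 - (B + q\<^sup>2)) =
         X * (1 + a n) * (A\<^sup>2 - B) + 2 * X * A * ((1 + a n) * q)"
        by (simp add: power2_eq_square algebra_simps)
      then show ?thesis by (simp only: q mult_1_right) (simp add: mult_ac)
    qed
    ultimately show ?case unfolding d0 d1 d2 IH by (simp add: q_def)
  qed
  then show "poly (pderiv (P n)) 1 = poly (P n) 1 * (\<Sum>i<n. 1 / (1 + a i))"
    "poly (pderiv (pderiv (P n))) 1 =
      poly (P n) 1 * ((\<Sum>i<n. 1 / (1 + a i))\<^sup>2 - (\<Sum>i<n. (1 / (1 + a i))\<^sup>2))"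
    by auto
qed

section \<open>The generating polynomial of the number of non-zero-blocks\<close>

lemma Bsum_cong: "(\<And>k. f k = g k) \<Longrightarrow> Bsum c m n f = Bsum c m n g"
  by (simp add: Bsum_def)

lemma Bsum_add: "Bsum c m n (\<lambda>k. f k + g k) = Bsum c m n f + Bsum c m n g"
  by (simp add: Bsum_def sum.distrib)

lemma Bsum_cmult: "Bsum c m n (\<lambda>k. a * f k) = a * Bsum c m n f"
  by (simp add: Bsum_def sum_distrib_left)

text \<open>On monomials the operator is exactly the step of \<open>Bsum_Suc\<close>; linearity then
  carries this over to the generating polynomials.\<close>

lemma whitney_op_monom:
  "whitney_op c m (monom 1 k) = monom 1 (Suc k) + of_nat (c + m * k) * (monom 1 k :: 'a::idom poly)"
proof (cases k)
  case 0
  then show ?thesis by (simp add: whitney_op_def of_nat_poly monom_Suc monom_0)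
next
  case (Suc j)
  then show ?thesis
    by (simp add: whitney_op_def pderiv_monom of_nat_poly smult_monom add_monom algebra_simps
      flip: monom_Suc)
qed

lemma pderiv_sum: "pderiv (sum f A) = (\<Sum>x\<in>A. pderiv (f x))"
  using higher_pderiv_sum[of 1 f A] by simp

lemma whitney_op_sum: "whitney_op c m (sum f A) = (\<Sum>x\<in>A. whitney_op c m (f x))"
  by (simp add: whitney_op_def pderiv_sum sum_distrib_left sum.distrib
      del: mult_pCons_left mult_pCons_right)

lemma Bsum_monom_Suc:
  "Bsum c m (Suc n) (monom (1::'a::idom)) = whitney_op c m (Bsum c m n (monom 1))"
  unfolding Bsum_Suc by (simp only: Bsum_def whitney_op_sum whitney_op_monom)

lemma Bsum_monom_splits:
  assumes "c > 0" "m > 0"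
  obtains a :: "nat \<Rightarrow> real" where "\<And>i. i < n \<Longrightarrow> a i > 0"
    "Bsum c m n (monom 1) = (\<Prod>i<n. [:a i, 1:])"
proof -
  \<comment> \<open>The induction carries the strict order of the \<open>a i\<close>, that is,
    simplicity of the roots, which \<open>whitney_op_splits\<close> requires.\<close>
  have "\<exists>a :: nat \<Rightarrow> real. (\<forall>i<n. a i > 0) \<and> (\<forall>j<n. \<forall>i<j. a i < a j) \<and>
      Bsum c m n (monom 1) = (\<Prod>i<n. [:a i, 1:])"
  proof (induction n)
    case 0
    then show ?case by (simp add: Bsum_0)
  next
    case (Suc n)
    then obtain a :: "nat \<Rightarrow> real" where a: "\<And>i. i < n \<Longrightarrow> a i > 0"
      "\<And>i j. i < j \<Longrightarrow> j < n \<Longrightarrow> a i < a j" "Bsum c m n (monom 1) = (\<Prod>i<n. [:a i, 1:])"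
      by blast
    obtain b where "whitney_op c m (\<Prod>i<n. [:a i, 1:]) = (\<Prod>i<Suc n. [:b i, 1:])"
      "\<forall>i<Suc n. b i > 0" "\<forall>j<Suc n. \<forall>i<j. b i < b j"
      by (rule whitney_op_splits[OF assms a(1,2)])
    then show ?case unfolding Bsum_monom_Suc a(3) by (intro exI[of _ b] conjI)
  qed
  then show ?thesis using that by blast
qed

lemma poly_Bsum_monom: "poly (Bsum c m n (monom 1)) x = Bsum c m n (\<lambda>k. x ^ k)"
  by (simp add: Bsum_def poly_sum poly_monom)

lemma poly_pderiv_Bsum_monom:
  "poly (pderiv (Bsum c m n (monom (1::real)))) 1 = Bsum c m n (\<lambda>k. real k)"
  by (simp add: Bsum_def pderiv_sum pderiv_monom poly_sum poly_monom)

lemma poly_pderiv2_Bsum_monom: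
  "poly (pderiv (pderiv (Bsum c m n (monom (1::real))))) 1 = Bsum c m n (\<lambda>k. real k * (real k - 1))"
proof -
  have *: "real (k - Suc 0) * real k = real k * (real k - 1)" for k by (cases k) auto
  show ?thesis by (simp add: Bsum_def pderiv_sum pderiv_monom poly_sum poly_monom *)
qed

text \<open>The difference would otherwise be a nonzero polynomial with infinitely many roots. This
  moves the real factorization to the complex numbers, where characteristic functions are
  evaluated.\<close>

lemma complex_poly_eqI_reals:
  fixes p q :: "complex poly"
  assumes "\<And>x :: real. poly p (of_real x) = poly q (of_real x)"
  shows "p = q"
proof (rule ccontr)
  assume "p \<noteq> q"
  then have "finite {z. poly (p - q) z = 0}" by (intro poly_roots_finite) auto
  moreover have "range complex_of_real \<subseteq> {z. poly (p - q) z = 0}" using assms by auto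
  ultimately have "finite (range complex_of_real)" by (rule rev_finite_subset)
  then show False using infinite_UNIV_char_0[where 'a=real]
    by (simp add: finite_image_iff inj_on_def)
qed

lemma Bsum_power_complex:
  fixes a :: "nat \<Rightarrow> real" and z :: complex
  assumes "Bsum c m n (monom 1) = (\<Prod>i<n. [:a i, 1:])"
  shows "Bsum c m n (\<lambda>k. z ^ k) = (\<Prod>i<n. z + a i)"
proof -
  have "Bsum c m n (monom 1) = (\<Prod>i<n. [:complex_of_real (a i), 1:])"
  proof (rule complex_poly_eqI_reals)
    fix x :: real
    have "poly (Bsum c m n (monom 1)) (complex_of_real x) = of_real (Bsum c m n (\<lambda>k. x ^ k))"
      unfolding poly_Bsum_monom by (simp add: Bsum_def)
    also have "\<dots> = of_real (poly (\<Prod>i<n. [:a i, 1:]) x)"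
      by (simp only: poly_Bsum_monom[symmetric] assms)
    also have "\<dots> = poly (\<Prod>i<n. [:complex_of_real (a i), 1:]) (complex_of_real x)"
      by (simp add: poly_prod)
    finally show "poly (Bsum c m n (monom 1)) (complex_of_real x) =
      poly (\<Prod>i<n. [:complex_of_real (a i), 1:]) (complex_of_real x)" .
  qed
  then have "poly (Bsum c m n (monom 1)) z = (\<Prod>i<n. z + a i)"
    by (simp add: poly_prod add.commute)
  then show ?thesis by (simp add: poly_Bsum_monom)
qed

section \<open>Dobinski weights\<close>

text \<open>The quadratic term is essential: Bernoulli's inequality would place the mode
  \<open>J\<close> only at order n^(1/2), whereas flatness around it needs \<open>n\<close> to be
  small compared with \<open>J\<^sup>2\<close>.\<close>

lemma power_ge_second_order:
  fixes t :: real
  assumes "t \<ge> 0"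
  shows "1 + real n * t + real n * (real n - 1) / 2 * t\<^sup>2 \<le> (1 + t) ^ n"
proof (induction n)
  case (Suc n)
  have "1 + real (Suc n) * t + real (Suc n) * (real (Suc n) - 1) / 2 * t\<^sup>2 \<le>
    (1 + t) * (1 + real n * t + real n * (real n - 1) / 2 * t\<^sup>2)"
  proof -
    have "real n * (real n - 1) \<ge> 0" by (cases n) auto
    then have "0 \<le> t * (real n * (real n - 1) / 2 * t\<^sup>2)"
      using assms by (intro mult_nonneg_nonneg) auto
    then show ?thesis by (simp add: field_simps power2_eq_square)
  qed
  also have "\<dots> \<le> (1 + t) * (1 + t) ^ n" using Suc assms by (intro mult_left_mono) auto
  finally show ?case by simp
qed simp

lemma fact_add_le: "fact (J + i) \<le> fact J * real (J + i) ^ i"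
proof (induction i)
  case (Suc i)
  have "fact (J + Suc i) = real (J + Suc i) * fact (J + i)" by simp
  also have "\<dots> \<le> real (J + Suc i) * (fact J * real (J + i) ^ i)"
    using Suc by (intro mult_left_mono) auto
  also have "\<dots> \<le> real (J + Suc i) * (fact J * real (J + Suc i) ^ i)"
    by (intro mult_left_mono power_mono) auto
  finally show ?case by (simp add: algebra_simps)
qed simp

text \<open>The terms tend to 0, so from some index on they stay below \<open>w 0\<close>, and a
  maximum over the finite initial part is global.\<close>

lemma ex_argmax_of_summable:
  fixes w :: "nat \<Rightarrow> real"
  assumes "summable w" "w 0 > 0"
  obtains J where "\<And>j. w j \<le> w J"
proof -
  have "\<forall>\<^sub>F j in sequentially. w j < w 0"
    using summable_LIMSEQ_zero[OF assms(1)] assms(2) order_tendstoD(2) by blast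
  then obtain N where N: "\<And>j. j \<ge> N \<Longrightarrow> w j < w 0" by (auto simp: eventually_sequentially)
  have "Max (w ` {..N}) \<in> w ` {..N}" by (intro Max_in) auto
  then obtain J where "w J = Max (w ` {..N})" by (metis imageE)
  then have J: "w j \<le> w J" if "j \<le> N" for j using that by simp
  have "w j \<le> w J" for j
    using J[of j] J[of 0] N[of j] by (cases "j \<le> N") auto
  then show ?thesis by (rule that)
qed

text \<open>By Dobinski's formula these weights sum to \<open>exp (1/m)\<close> times the number of colored partitions.\<close>

definition dobinski_weight :: "nat \<Rightarrow> nat \<Rightarrow> nat \<Rightarrow> nat \<Rightarrow> real" where
  "dobinski_weight c m n j = real (m * j + c) ^ n / (real m ^ j * fact j)"

lemma dobinski_weight_nonneg: "dobinski_weight c m n j \<ge> 0"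
  by (simp add: dobinski_weight_def)

section \<open>The mode of the Dobinski weights and their flatness next to it\<close>

context
  fixes c m :: nat
  assumes c: "c > 0" and m: "m > 0"
begin

text \<open>Comparing the weight at \<open>J\<close> with its right neighbor gives
  \<open>(1 + m / y) ^ n \<le> m * (J + 1)\<close> for y = m J + c; the quadratic term on the left
  and \<open>y \<le> (m + c) * (J + 1)\<close> yield the claim.\<close>

lemma dobinski_argmax_ge:
  assumes J: "\<And>j. dobinski_weight c m n j \<le> dobinski_weight c m n J" and n: "n \<ge> 2"
  shows "n\<^sup>2 \<le> 4 * (m + c)\<^sup>2 * (J + 1) ^ 3"
proof -
  define y where "y = real (m * J + c)"
  have y: "y > 0" using c by (simp add: y_def add_nonneg_pos)
  have "real (m * Suc J + c) ^ n / (real m ^ Suc J * fact (Suc J)) \<le> y ^ n / (real m ^ J * fact J)"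
    using J[of "Suc J"] by (simp add: dobinski_weight_def y_def)
  then have "real (m * Suc J + c) ^ n \<le> y ^ n * (real m * (real J + 1))"
    using m by (simp add: field_simps del: of_nat_Suc of_nat_add of_nat_mult) (simp add: algebra_simps)
  moreover have "real (m * Suc J + c) = y * (1 + m / y)"
    using y by (simp add: y_def field_simps)
  ultimately have "(1 + m / y) ^ n \<le> real m * (real J + 1)"
    using y by (simp add: power_mult_distrib)
  moreover have "real n * (real n - 1) / 2 * (m / y)\<^sup>2 \<le> (1 + m / y) ^ n"
  proof -
    have "0 \<le> real m / y" "0 \<le> real n * (real m / y)" using y by simp_all
    then show ?thesis using power_ge_second_order[of "m / y" n] by linarith
  qed
  ultimately have "real n * (real n - 1) / 2 * (m / y)\<^sup>2 \<le> real m * (real J + 1)"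
    by linarith
  then have "real n * (real n - 1) * (real m)\<^sup>2 \<le> 2 * real m * (real J + 1) * y\<^sup>2"
    using y by (simp add: field_simps power_divide)
  then have "real n * (real n - 1) * real m \<le> 2 * (real J + 1) * y\<^sup>2"
    using m by (simp add: power2_eq_square) (simp add: algebra_simps)
  moreover have "real n * real n / 2 \<le> real n * (real n - 1) * real m"
  proof -
    have "real n * (real n / 2) \<le> real n * (real n - 1)"
      using n by (intro mult_left_mono) auto
    also have "\<dots> \<le> real n * (real n - 1) * real m"
      using m n mult_left_mono[of 1 "real m" "real n * (real n - 1)"] by simp
    finally show ?thesis by simp
  qed
  moreover have "2 * (real J + 1) * y\<^sup>2 \<le> 2 * (real J + 1) * ((real m + real c) * (real J + 1))\<^sup>2"
    using y unfolding y_def by (intro mult_left_mono power_mono) (auto simp: algebra_simps)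
  ultimately have "real n * real n / 2 \<le> 2 * (real J + 1) * ((real m + real c) * (real J + 1))\<^sup>2"
    by linarith
  then have "(real n)\<^sup>2 \<le> 2 * (2 * (real J + 1) * ((real m + real c) * (real J + 1))\<^sup>2)"
    unfolding power2_eq_square[of "real n"] by linarith
  also have "\<dots> = real (4 * (m + c)\<^sup>2 * (J + 1) ^ 3)"
    by (simp add: power2_eq_square power3_eq_cube algebra_simps)
  finally have "real (n\<^sup>2) \<le> real (4 * (m + c)\<^sup>2 * (J + 1) ^ 3)" by simp
  then show ?thesis by (simp only: of_nat_le_iff)
qed

text \<open>Comparison with the left neighbor of \<open>J\<close> gives
  \<open>z ^ n * (m * J) \<le> 1\<close> for z = 1 - m/y. Inserting the \<open>i\<close>-th power of
  this bounds the ratio of the weights at \<open>J + i\<close> and \<open>J\<close> below by ((1 +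
  u) z^i)^n (J/(J + i))^i. Since z^i is at least 1 - u, Bernoulli's inequality makes both factors at
  least 3/4, and 9/16 exceeds 1/2.\<close>

lemma dobinski_flat_near_argmax:
  assumes J: "\<And>j. dobinski_weight c m n j \<le> dobinski_weight c m n J"
    and J0: "J > 0" and i: "i \<le> K" and JK: "4 * K\<^sup>2 \<le> J" "4 * K\<^sup>2 * n \<le> J\<^sup>2"
  shows "dobinski_weight c m n J / 2 \<le> dobinski_weight c m n (J + i)"
proof -
  let ?w = "dobinski_weight c m n"
  define y where "y = real (m * J + c)"
  define u where "u = real m * real i / y"
  define z where "z = 1 - real m / y"
  have y: "y > 0" using c by (simp add: y_def add_nonneg_pos)
  have mJ: "real m * real J \<le> y" by (simp add: y_def)
  obtain J' where J': "J = Suc J'" using J0 by (cases J) auto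
  have ym: "y - real m = real (m * J' + c)" by (simp add: y_def J' algebra_simps)
  have "y - real m > 0" using c unfolding ym by (simp add: add_nonneg_pos)
  then have z: "0 < z" using y by (simp add: z_def)
  have zy: "z * y = y - real m" using y by (simp add: z_def field_simps)
  define F where "F = real m ^ J' * fact J'"
  have F: "F > 0" using m by (simp add: F_def)
  have J_pos: "real J > 0" using J0 by simp
  have "(z * y) ^ n / F \<le> y ^ n / (real m ^ Suc J' * fact (Suc J'))"
    using J[of J'] unfolding zy ym by (simp add: dobinski_weight_def y_def J' F_def)
  also have "real m ^ Suc J' * fact (Suc J') = F * (real m * real J)"
    by (simp add: F_def J')
  finally have "(z * y) ^ n / F * (F * (real m * real J) / y ^ n) \<le>
      y ^ n / (F * (real m * real J)) * (F * (real m * real J) / y ^ n)"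
    using F y by (intro mult_right_mono) auto
  then have "z ^ n * (real m * real J) \<le> 1"
    using F m y J_pos by (simp add: power_mult_distrib)
  then have zn: "(z ^ n * (real m * real J)) ^ i \<le> 1"
    using z by (intro power_le_one) auto
  have "i\<^sup>2 \<le> K\<^sup>2" using i by (simp add: power_mono)
  have u0: "u \<ge> 0" using y by (simp add: u_def)
  have nu: "real n * u\<^sup>2 \<le> 1 / 4"
  proof -
    have "4 * (real n * (real m * real i)\<^sup>2) = (real m)\<^sup>2 * real (4 * i\<^sup>2 * n)"
      by (simp add: power_mult_distrib)
    also have "\<dots> \<le> (real m)\<^sup>2 * real (J\<^sup>2)"
      using \<open>i\<^sup>2 \<le> K\<^sup>2\<close> JK(2) by (intro mult_left_mono of_nat_mono)
        (auto intro: order_trans[OF _ JK(2)])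
    also have "\<dots> = (real m * real J)\<^sup>2" by (simp add: power_mult_distrib)
    also have "\<dots> \<le> y\<^sup>2" using mJ by (intro power_mono) auto
    finally show ?thesis using y by (simp add: u_def power_divide field_simps)
  qed
  have u1: "u \<le> 1"
  proof -
    have "i \<le> i\<^sup>2" unfolding power2_eq_square by (rule le_square)
    then have "i \<le> J" using \<open>i\<^sup>2 \<le> K\<^sup>2\<close> JK(1) by linarith
    then have "real m * real i \<le> real m * real J" by (intro mult_left_mono) auto
    then show ?thesis using mJ y by (simp add: u_def field_simps)
  qed
  have zi: "1 - u \<le> z ^ i"
    using Bernoulli_inequality[of "- (real m / y)" i] z by (simp add: z_def u_def mult.commute)
  have A: "3 / 4 \<le> (1 + u) ^ n * (z ^ n) ^ i"
  proof -
    have "3 / 4 \<le> 1 + real n * (- u\<^sup>2)" using nu by simp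
    also have "\<dots> \<le> (1 + (- u\<^sup>2)) ^ n"
      using u0 u1 by (intro Bernoulli_inequality) (simp add: power_le_one)
    also have "1 + (- u\<^sup>2) = (1 + u) * (1 - u)" by (simp add: power2_eq_square algebra_simps)
    also have "\<dots> ^ n \<le> ((1 + u) * z ^ i) ^ n"
      using zi u0 u1 by (intro power_mono mult_left_mono) auto
    also have "\<dots> = (1 + u) ^ n * (z ^ n) ^ i"
      by (simp add: power_mult_distrib flip: power_mult) (simp add: mult.commute)
    finally show ?thesis .
  qed
  have B: "3 / 4 \<le> (real J / real (J + i)) ^ i"
  proof -
    have "4 * i\<^sup>2 \<le> J" using \<open>i\<^sup>2 \<le> K\<^sup>2\<close> JK(1) by linarith
    then have "real (4 * i\<^sup>2) \<le> real J" by (simp only: of_nat_le_iff)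
    then have "4 * (real i)\<^sup>2 \<le> real J" by simp
    then have "3 / 4 \<le> 1 + real i * (- (real i / real (J + i)))"
      using J_pos by (simp add: field_simps power2_eq_square)
    also have "\<dots> \<le> (1 + (- (real i / real (J + i)))) ^ i"
      using J_pos by (intro Bernoulli_inequality) (simp add: field_simps)
    also have "1 + (- (real i / real (J + i))) = real J / real (J + i)"
      using J_pos by (simp add: field_simps)
    finally show ?thesis .
  qed
  have "?w J / 2 \<le> ?w J * (3 / 4 * (3 / 4))"
    using dobinski_weight_nonneg[of c m n J] by simp
  also have "\<dots> \<le> ?w J * (((1 + u) ^ n * (z ^ n) ^ i) * (real J / real (J + i)) ^ i)"
    using A B dobinski_weight_nonneg[of c m n J] by (intro mult_left_mono mult_mono) auto
  also have "\<dots> = ?w J * ((1 + u) ^ n / (real m * real (J + i)) ^ i * (z ^ n * (real m * real J)) ^ i)"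
    using m J_pos by (simp add: power_mult_distrib power_divide)
  also have "\<dots> \<le> ?w J * ((1 + u) ^ n / (real m * real (J + i)) ^ i * 1)"
    using zn u0 dobinski_weight_nonneg[of c m n J] by (intro mult_left_mono) auto
  also have "\<dots> = (y * (1 + u)) ^ n / (real m ^ (J + i) * (fact J * real (J + i) ^ i))"
    by (simp add: dobinski_weight_def y_def power_mult_distrib power_add)
  also have "y * (1 + u) = real (m * (J + i) + c)"
    using y by (simp add: u_def field_simps) (simp add: y_def algebra_simps)
  also have "\<dots> ^ n / (real m ^ (J + i) * (fact J * real (J + i) ^ i)) \<le> ?w (J + i)"
    unfolding dobinski_weight_def using m J_pos
    by (intro divide_left_mono mult_left_mono fact_add_le mult_pos_pos) auto
  finally show ?thesis .
qed

text \<open>The \<open>K + 1\<close> weights from the mode onwards are each at least half the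
  maximum, and together at most the whole sum.\<close>

lemma dobinski_weight_spread:
  assumes "\<And>n. summable (dobinski_weight c m n)"
  shows "\<forall>\<^sub>F n in sequentially. \<forall>j. real (K + 1) * dobinski_weight c m n j \<le> 2 * suminf (dobinski_weight c m n)"
proof -
  define A where "A = (m + c)\<^sup>2"
  \<comment> \<open>Once \<open>B \<le> J\<close>, the three summands give in turn
    \<open>4 * K\<^sup>2 * n \<le> J\<^sup>2\<close>, \<open>4 * K\<^sup>2 \<le> J\<close> and
    \<open>J > 0\<close>.\<close>
  define B where "B = 512 * K ^ 4 * A + 4 * K\<^sup>2 + 1"
  have "\<forall>\<^sub>F n in sequentially. n \<ge> 4 * A * B ^ 3 + 2" by (rule eventually_ge_at_top)
  then show ?thesis
  proof (rule eventually_mono, intro allI)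
    fix n j :: nat
    assume n: "n \<ge> 4 * A * B ^ 3 + 2"
    let ?w = "dobinski_weight c m n"
    have "?w 0 > 0" using c by (simp add: dobinski_weight_def)
    then obtain J where J: "\<And>j. ?w j \<le> ?w J" using ex_argmax_of_summable[OF assms[of n]] by blast
    have nJ: "n\<^sup>2 \<le> 4 * A * (J + 1) ^ 3"
      using dobinski_argmax_ge[OF J] n by (simp add: A_def)
    have "B \<le> J"
    proof (rule ccontr)
      assume "\<not> B \<le> J"
      \<comment> \<open>A mode below \<open>B\<close> would give
        \<open>n\<^sup>2 \<le> 4 * A * B ^ 3 < n\<close>.\<close>
      then have "(J + 1) ^ 3 \<le> B ^ 3" by (intro power_mono) auto
      then have "4 * A * (J + 1) ^ 3 \<le> 4 * A * B ^ 3" by simp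
      then have "n * n < n" using nJ n unfolding power2_eq_square by linarith
      then show False by (cases n) auto
    qed
    then have JB: "J > 0" "4 * K\<^sup>2 \<le> J" "512 * K ^ 4 * A \<le> J" by (auto simp: B_def)
    \<comment> \<open>Squaring allows the bound on \<open>n\<^sup>2\<close> to be used directly; 512
      arises as 16 * 4 * 8, the 8 from \<open>J + 1 \<le> 2 * J\<close>.\<close>
    have "(4 * K\<^sup>2 * n)\<^sup>2 = 16 * K ^ 4 * n\<^sup>2" by (simp add: power_mult_distrib flip: power_mult)
    also have "\<dots> \<le> 16 * K ^ 4 * (4 * A * (J + 1) ^ 3)" using nJ by (intro mult_left_mono) auto
    also have "\<dots> \<le> 16 * K ^ 4 * (4 * A * (2 * J) ^ 3)"
      using JB(1) by (intro mult_left_mono power_mono) auto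
    also have "\<dots> = (512 * K ^ 4 * A) * J ^ 3" by (simp add: power_mult_distrib)
    also have "\<dots> \<le> J * J ^ 3" using JB(3) by (intro mult_right_mono) auto
    also have "\<dots> = (J\<^sup>2)\<^sup>2" by (simp add: eval_nat_numeral)
    finally have "4 * K\<^sup>2 * n \<le> J\<^sup>2" by (simp only: power2_nat_le_eq_le)
    then have flat: "?w J / 2 \<le> ?w (J + i)" if "i \<le> K" for i
      using dobinski_flat_near_argmax[OF J JB(1) that JB(2)] by blast
    have "real (K + 1) * ?w j \<le> real (K + 1) * ?w J" using J by (intro mult_left_mono) auto
    also have "\<dots> = 2 * (\<Sum>i\<le>K. ?w J / 2)" by simp
    also have "\<dots> \<le> 2 * (\<Sum>i\<le>K. ?w (J + i))" using flat by (intro mult_left_mono sum_mono) auto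
    also have "(\<Sum>i\<le>K. ?w (J + i)) = (\<Sum>k\<in>(+) J ` {..K}. ?w k)" by (simp add: sum.reindex)
    also have "\<dots> \<le> suminf ?w"
      by (intro sum_le_suminf assms) (auto simp: dobinski_weight_nonneg)
    finally show "real (K + 1) * ?w j \<le> 2 * suminf ?w" by simp
  qed
qed

end

text \<open>At most \<open>2 * R + 1\<close> naturals lie within distance less than \<open>R\<close>
  of \<mu>, and by the spread assumption they carry at most half of the mass. The other half
  contributes at least \<open>R\<^sup>2\<close> per unit of mass, whatever the center \<mu>.\<close>

lemma second_moment_ge_of_spread:
  fixes w :: "nat \<Rightarrow> real" and \<mu> :: real and R :: nat
  assumes w: "\<And>j. w j \<ge> 0" "summable w" and s: "summable (\<lambda>j. w j * (real j - \<mu>)\<^sup>2)"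
    and spread: "\<And>j. real (4 * R + 2) * w j \<le> suminf w"
  shows "(real R)\<^sup>2 / 2 * suminf w \<le> (\<Sum>j. w j * (real j - \<mu>)\<^sup>2)"
proof -
  define A where "A = {j. \<bar>real j - \<mu>\<bar> < real R}"
  have sub: "A \<subseteq> nat ` {\<lfloor>\<mu>\<rfloor> - int R..\<lfloor>\<mu>\<rfloor> + int R}"
  proof
    fix j assume "j \<in> A"
    then have "int j \<in> {\<lfloor>\<mu>\<rfloor> - int R..\<lfloor>\<mu>\<rfloor> + int R}" unfolding A_def by (simp; linarith)
    then show "j \<in> nat ` {\<lfloor>\<mu>\<rfloor> - int R..\<lfloor>\<mu>\<rfloor> + int R}" by (intro image_eqI[of _ _ "int j"]) auto
  qed
  then have fin: "finite A" using finite_subset by blast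
  have "card A \<le> card {\<lfloor>\<mu>\<rfloor> - int R..\<lfloor>\<mu>\<rfloor> + int R}"
    using sub by (meson card_image_le card_mono finite_atLeastAtMost_int finite_imageI order_trans)
  then have cA: "card A \<le> 2 * R + 1" by simp
  have "real (4 * R + 2) * (\<Sum>j\<in>A. w j) \<le> (\<Sum>j\<in>A. suminf w)"
    using spread by (simp only: sum_distrib_left) (intro sum_mono)
  also have "\<dots> \<le> real (2 * R + 1) * suminf w"
    using cA suminf_nonneg[OF w(2,1)] by (simp only: sum_constant) (intro mult_right_mono; simp)
  finally have "real (2 * R + 1) * (2 * (\<Sum>j\<in>A. w j)) \<le> real (2 * R + 1) * suminf w"
    by (simp add: algebra_simps)
  then have half: "2 * (\<Sum>j\<in>A. w j) \<le> suminf w" by (subst (asm) mult_le_cancel_left_pos) auto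
  have sA: "(\<lambda>j. if j \<in> A then w j else 0) sums (\<Sum>j\<in>A. w j)" by (rule sums_If_finite_set[OF fin])
  have "(\<lambda>j. (real R)\<^sup>2 * (w j - (if j \<in> A then w j else 0))) sums
      ((real R)\<^sup>2 * (suminf w - (\<Sum>j\<in>A. w j)))"
    by (intro sums_mult sums_diff sA summable_sums w)
  moreover have "(real R)\<^sup>2 * (w j - (if j \<in> A then w j else 0)) \<le> w j * (real j - \<mu>)\<^sup>2" for j
  proof (cases "j \<in> A")
    case False
    then have "(real R)\<^sup>2 \<le> (real j - \<mu>)\<^sup>2" unfolding A_def by (simp add: abs_le_square_iff[symmetric])
    then show ?thesis using False w(1)[of j] by (simp add: mult.commute mult_left_mono)
  qed (use w in auto)
  ultimately have "(real R)\<^sup>2 * (suminf w - (\<Sum>j\<in>A. w j)) \<le> (\<Sum>j. w j * (real j - \<mu>)\<^sup>2)"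
    using s by (intro sums_le[OF _ _ summable_sums[OF s]])
  moreover have "(real R)\<^sup>2 / 2 * suminf w \<le> (real R)\<^sup>2 * (suminf w - (\<Sum>j\<in>A. w j))"
  proof -
    have "(real R)\<^sup>2 * (suminf w / 2) \<le> (real R)\<^sup>2 * (suminf w - (\<Sum>j\<in>A. w j))"
      using half by (intro mult_left_mono) auto
    then show ?thesis by simp
  qed
  ultimately show ?thesis by linarith
qed

section \<open>Growth of the variance\<close>

text \<open>The expansion in the falling factorials \<open>fact k * (j choose k)\<close>: since m j
  + c = (c + m k) + m (j - k), multiplication by m j + c acts on the k-th term as the step of
  \<open>Bsum_Suc\<close>. For \<open>k > j\<close> the binomial coefficient vanishes.\<close>

lemma power_eq_Bsum:
  "real (m * j + c) ^ n = Bsum c m n (\<lambda>k. real m ^ k * (fact k * real (j choose k)))"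
proof (induction n)
  case (Suc n)
  have *: "fact (Suc k) * real (j choose Suc k) = fact k * real (j choose k) * (real j - real k)" for k
  proof -
    have "Suc k * (j choose Suc k) = (j choose k) * (j - k)"
      using Suc_times_binomial[of k "j - 1"] binomial_absorb_comp[of j k]
      by (cases j) (simp_all add: mult.commute del: mult_Suc mult_Suc_right binomial_Suc_Suc)
    then have "real (Suc k) * real (j choose Suc k) = real (j choose k) * real (j - k)"
      by (metis of_nat_mult)
    moreover have "real (j choose k) * real (j - k) = real (j choose k) * (real j - real k)"
      by (cases "k \<le> j") (auto simp: of_nat_diff binomial_eq_0)
    moreover have "fact (Suc k) * real (j choose Suc k) = fact k * (real (Suc k) * real (j choose Suc k))"
      by (simp add: algebra_simps)
    ultimately show ?thesis by (simp only: mult.assoc)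
  qed
  have "real m ^ Suc k * (fact (Suc k) * real (j choose Suc k)) +
      real (c + m * k) * (real m ^ k * (fact k * real (j choose k))) =
      real (m * j + c) * (real m ^ k * (fact k * real (j choose k)))" for k
    unfolding * by (simp add: algebra_simps)
  then show ?case by (simp only: Bsum_Suc Bsum_cmult Suc power_Suc)
qed (simp add: Bsum_0)

text \<open>After the expansion by \<open>power_eq_Bsum\<close>, the term of each partition sums to
  exp(1/m): its first k summands vanish, and the rest is the exponential series shifted by
  k.\<close>

lemma dobinski_sums:
  assumes m: "m > 0"
  shows "dobinski_weight c m n sums (exp (1 / real m) * Bsum c m n (\<lambda>_. 1))"
proof -
  have *: "(\<lambda>j. real m ^ k * (fact k * real (j choose k)) / (real m ^ j * fact j)) sums exp (1 / real m)"
    (is "?f sums _") for k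
  proof -
    have "?f (i + k) = (1 / real m) ^ i /\<^sub>R fact i" for i
    proof -
      have "fact k * real ((i + k) choose k) = fact (i + k) / fact i"
        using binomial_fact[of k "i + k", where 'a=real] by simp
      then show ?thesis using m by (simp add: power_add field_simps scaleR_conv_of_real)
    qed
    then have "(\<lambda>i. ?f (i + k)) sums exp (1 / real m)"
      using exp_converges[of "1 / real m"] by simp
    then show ?thesis by (subst (asm) sums_zero_iff_shift) (auto simp: binomial_eq_0)
  qed
  have "(\<lambda>j. \<Sum>\<pi>\<in>Bpart c m n. real m ^ nonzero_blocks \<pi> *
      (fact (nonzero_blocks \<pi>) * real (j choose nonzero_blocks \<pi>)) / (real m ^ j * fact j))
      sums (\<Sum>\<pi>\<in>Bpart c m n. exp (1 / real m))"
    by (intro sums_sum *)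
  then show ?thesis
    by (simp only: Bsum_def power_eq_Bsum dobinski_weight_def[abs_def] sum_divide_distrib
      sum_distrib_left mult_1_right)
qed

text \<open>The generating polynomial at 1 is a product of factors \<open>1 + a i\<close>.
  Positivity also shows that \<open>Bpart\<close> is nonempty, as the uniform distribution
  requires.\<close>

lemma Bsum_1_pos: 
  assumes "c > 0" "m > 0"
  shows "Bsum c m n (\<lambda>_. 1 :: real) > 0"
proof -
  obtain a :: "nat \<Rightarrow> real" where a: "\<And>i. i < n \<Longrightarrow> a i > 0"
      "Bsum c m n (monom 1) = (\<Prod>i<n. [:a i, 1:])"
    using Bsum_monom_splits[OF assms] by blast
  have "Bsum c m n (\<lambda>_. 1 :: real) = poly (Bsum c m n (monom 1)) 1" by (simp add: poly_Bsum_monom)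
  also have "\<dots> = (\<Prod>i<n. 1 + a i)" by (simp add: a(2) poly_prod add.commute)
  also have "\<dots> > 0" using a(1) by (intro prod_pos) (simp add: add_pos_pos)
  finally show ?thesis .
qed

section \<open>Mean and variance of the number of non-zero-blocks\<close>

context
  fixes c m :: nat
  assumes c: "c > 0" and m: "m > 0"
begin

lemma expectation_pmf_of_set_Bpart:
  fixes f :: "nat \<Rightarrow> 'a::{banach, second_countable_topology, real_normed_field}"
  shows "measure_pmf.expectation (pmf_of_set (Bpart c m n)) (\<lambda>\<pi>. f (nonzero_blocks \<pi>)) =
    Bsum c m n f / of_real (Bsum c m n (\<lambda>_. 1))"
proof -
  have "Bpart c m n \<noteq> {}" using Bsum_1_pos[OF c m, of n] by (auto simp: Bsum_def)
  then show ?thesis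
    using integral_measure_pmf[of "Bpart c m n" "pmf_of_set (Bpart c m n)" "\<lambda>\<pi>. f (nonzero_blocks \<pi>)"]
    by (simp add: finite_Bpart Bsum_def scaleR_conv_of_real sum_divide_distrib[symmetric])
qed

lemma E_xi_eq: "E_xi c m n = Bsum c m n real / Bsum c m n (\<lambda>_. 1)"
  using expectation_pmf_of_set_Bpart[of n real] by (simp add: E_xi_def xi_pmf_def)

lemma V_xi_eq:
  "V_xi c m n = Bsum c m n (\<lambda>k. (real k)\<^sup>2) / Bsum c m n (\<lambda>_. 1) - (E_xi c m n)\<^sup>2"
proof -
  define e where "e = E_xi c m n"
  define D where "D = Bsum c m n (\<lambda>_. 1 :: real)"
  have D: "D > 0" using Bsum_1_pos[OF c m] by (simp add: D_def)
  have S: "Bsum c m n real = e * D" using D by (simp add: e_def E_xi_eq D_def)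
  have "V_xi c m n = Bsum c m n (\<lambda>k. (real k - e)\<^sup>2) / D"
    using expectation_pmf_of_set_Bpart[of n "\<lambda>k. (real k - e)\<^sup>2"]
    by (simp add: V_xi_def xi_pmf_def e_def D_def E_xi_def)
  also have "Bsum c m n (\<lambda>k. (real k - e)\<^sup>2) =
      Bsum c m n (\<lambda>k. (real k)\<^sup>2 + (- 2 * e) * real k + e\<^sup>2 * 1)"
    by (intro Bsum_cong) (simp add: power2_eq_square algebra_simps)
  also have "\<dots> = Bsum c m n (\<lambda>k. (real k)\<^sup>2) - e\<^sup>2 * D"
    by (simp only: Bsum_add Bsum_cmult S D_def[symmetric]) (simp add: power2_eq_square)
  also have "\<dots> / D = Bsum c m n (\<lambda>k. (real k)\<^sup>2) / D - e\<^sup>2" using D by (simp add: diff_divide_distrib)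
  finally show ?thesis by (simp add: D_def e_def)
qed

text \<open>Comparing the weight sums of orders \<open>n\<close>, \<open>n + 1\<close>, \<open>n + 2\<close> shows that the distribution
  proportional to the Dobinski weights has variance \<open>V_xi c m n + 1 / m\<close>: it is the law of the
  number of non-zero-blocks plus an independent Poisson variable of parameter \<open>1 / m\<close>.\<close>

lemma V_xi_ge_of_spread:
  assumes spread: "\<And>j. real (4 * R + 2) * dobinski_weight c m n j \<le> suminf (dobinski_weight c m n)"
  shows "V_xi c m n \<ge> (real R)\<^sup>2 / 2 - 1"
proof -
  define D where "D k = Bsum c m k (\<lambda>_. 1 :: real)" for k
  define S1 S2 where "S1 = Bsum c m n real" and "S2 = Bsum c m n (\<lambda>k. (real k)\<^sup>2)"
  define L where "L = exp (1 / real m)"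
  have L: "L > 0" by (simp add: L_def)
  have D: "D k > 0" for k using Bsum_1_pos[OF c m] by (simp add: D_def)
  \<comment> \<open>One step of the recurrence turns the constant 1 into a linear function of k, two
    steps into a quadratic one, so \<open>D\<close> at \<open>n + 1\<close> and \<open>n + 2\<close>
    encodes the first two moments.\<close>
  have D1: "D (Suc n) = (1 + real c) * D n + real m * S1"
  proof -
    have "D (Suc n) = Bsum c m n (\<lambda>k. (1 + real c) * 1 + real m * real k)"
      unfolding D_def Bsum_Suc by (intro Bsum_cong) simp
    then show ?thesis by (simp only: Bsum_add Bsum_cmult D_def S1_def)
  qed
  have D2: "D (Suc (Suc n)) = ((1 + real c)\<^sup>2 + real m) * D n + (2 * (1 + real c) * real m) * S1
      + (real m)\<^sup>2 * S2"
  proof -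
    have "D (Suc (Suc n)) = Bsum c m n (\<lambda>k. ((1 + real c)\<^sup>2 + real m) * 1 +
        (2 * (1 + real c) * real m) * real k + (real m)\<^sup>2 * (real k)\<^sup>2)"
      unfolding D_def Bsum_Suc by (intro Bsum_cong) (simp add: power2_eq_square algebra_simps)
    then show ?thesis by (simp only: Bsum_add Bsum_cmult D_def S1_def S2_def)
  qed
  have V: "V_xi c m n * D n = S2 - S1\<^sup>2 / D n"
    using D[of n] by (simp add: V_xi_eq E_xi_eq S1_def S2_def D_def[symmetric] field_simps power2_eq_square)
  \<comment> \<open>Under the normalized weights of order \<open>n\<close>, \<mu> is the mean of m j
    + c and \<nu> that of j.\<close>
  define \<mu> where "\<mu> = D (Suc n) / D n"
  define \<nu> where "\<nu> = (\<mu> - real c) / real m"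
  have dob: "dobinski_weight c m k sums (L * D k)" for k
    using dobinski_sums[OF m] by (simp add: L_def D_def)
  \<comment> \<open>Multiplying a weight by m j + c raises its order by one, so the centered square
    is a combination of three consecutive orders.\<close>
  have wsq: "dobinski_weight c m n j * (real j - \<nu>)\<^sup>2 =
      (dobinski_weight c m (Suc (Suc n)) j - 2 * \<mu> * dobinski_weight c m (Suc n) j
        + \<mu>\<^sup>2 * dobinski_weight c m n j) / (real m)\<^sup>2" for j
  proof -
    have "real m * (real j - \<nu>) = real (m * j + c) - \<mu>"
      using m by (simp add: \<nu>_def field_simps)
    then have "(real m)\<^sup>2 * (real j - \<nu>)\<^sup>2 = (real (m * j + c) - \<mu>)\<^sup>2"
      by (metis power_mult_distrib)
    then have "dobinski_weight c m n j * (real j - \<nu>)\<^sup>2 =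
      dobinski_weight c m n j * (real (m * j + c) - \<mu>)\<^sup>2 / (real m)\<^sup>2"
      using m by (simp add: field_simps del: of_nat_add of_nat_mult)
    moreover have "dobinski_weight c m (Suc k) j = real (m * j + c) * dobinski_weight c m k j" for k
      by (simp add: dobinski_weight_def)
    ultimately show ?thesis
      by (simp add: power2_eq_square algebra_simps del: of_nat_add of_nat_mult)
  qed
  have sums: "(\<lambda>j. dobinski_weight c m n j * (real j - \<nu>)\<^sup>2) sums
      ((L * D (Suc (Suc n)) - 2 * \<mu> * (L * D (Suc n)) + \<mu>\<^sup>2 * (L * D n)) / (real m)\<^sup>2)"
    unfolding wsq by (intro sums_divide sums_add sums_diff sums_mult dob)
  have "L * D (Suc (Suc n)) - 2 * \<mu> * (L * D (Suc n)) + \<mu>\<^sup>2 * (L * D n) =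
      L * (D (Suc (Suc n)) - (D (Suc n))\<^sup>2 / D n)"
    using D[of n] by (simp add: \<mu>_def field_simps power2_eq_square)
  also have "D (Suc (Suc n)) - (D (Suc n))\<^sup>2 / D n = (real m)\<^sup>2 * (S2 - S1\<^sup>2 / D n) + real m * D n"
    using D[of n] unfolding D1 D2 by (simp add: field_simps power2_eq_square)
  also have "\<dots> = (real m)\<^sup>2 * (V_xi c m n * D n) + real m * D n" by (simp only: V)
  also have "\<dots> = (real m)\<^sup>2 * ((V_xi c m n + 1 / real m) * D n)"
    using m by (simp add: field_simps power2_eq_square)
  finally have "(\<Sum>j. dobinski_weight c m n j * (real j - \<nu>)\<^sup>2) = L * D n * (V_xi c m n + 1 / real m)"
    using sums_unique[OF sums] m by (simp add: mult_ac)
  moreover have "(real R)\<^sup>2 / 2 * suminf (dobinski_weight c m n) \<le>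
      (\<Sum>j. dobinski_weight c m n j * (real j - \<nu>)\<^sup>2)"
    using sums dob[of n] spread
    by (intro second_moment_ge_of_spread dobinski_weight_nonneg) (auto simp: sums_iff)
  moreover have "suminf (dobinski_weight c m n) = L * D n" using dob[of n] by (simp add: sums_iff)
  ultimately have "(L * D n) * ((real R)\<^sup>2 / 2) \<le> (L * D n) * (V_xi c m n + 1 / real m)"
    by (simp add: mult.commute)
  moreover have "L * D n > 0" using L D by simp
  ultimately have "(real R)\<^sup>2 / 2 \<le> V_xi c m n + 1 / real m" by (metis mult_le_cancel_left_pos)
  moreover have "1 / real m \<le> 1" using m by simp
  ultimately show ?thesis by linarith
qed

lemma V_xi_at_top: "filterlim (V_xi c m) at_top sequentially"
  unfolding filterlim_at_top
proof
  fix Z :: real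
  obtain R :: nat where R: "real R \<ge> 2 * \<bar>Z\<bar> + 2" using real_arch_simple by blast
  then have "2 * \<bar>Z\<bar> + 2 \<le> (real R)\<^sup>2"
    using self_le_power[of "real R" 2] by linarith
  then have RZ: "(real R)\<^sup>2 / 2 - 1 \<ge> Z" by linarith
  have "summable (dobinski_weight c m n)" for n using dobinski_sums[OF m] by (simp add: sums_iff)
  \<comment> \<open>This choice gives 8 R + 4 = 2 (4 R + 2), which cancels the factor 2 of the
    spread bound.\<close>
  from dobinski_weight_spread[OF c m this, of "8 * R + 3"]
  show "\<forall>\<^sub>F n in sequentially. Z \<le> V_xi c m n"
  proof (rule eventually_mono)
    fix n assume *: "\<forall>j. real (8 * R + 3 + 1) * dobinski_weight c m n j \<le> 2 * suminf (dobinski_weight c m n)"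
    have two: "real (8 * R + 3 + 1) = 2 * real (4 * R + 2)" by simp
    have "V_xi c m n \<ge> (real R)\<^sup>2 / 2 - 1"
      by (rule V_xi_ge_of_spread) (use * two in \<open>simp only: mult.assoc mult_le_cancel_left_pos zero_less_numeral\<close>)
    then show "Z \<le> V_xi c m n" using RZ by linarith
  qed
qed

end

section \<open>Characteristic functions\<close>

text \<open>\<open>exp (- x)\<close> lies between \<open>1 - x\<close> and
  \<open>1 / (1 + x)\<close>.\<close>

lemma exp_minus_linear_approx:
  fixes x :: real
  assumes "x \<ge> 0"
  shows "\<bar>exp (- x) - (1 - x)\<bar> \<le> x\<^sup>2"
proof -
  have "exp (- x) \<ge> 1 - x" using exp_ge_add_one_self[of "- x"] by simp
  moreover have "exp (- x) \<le> 1 / (1 + x)"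
    using exp_ge_add_one_self[of x] assms by (simp add: exp_minus field_simps)
  moreover have "1 / (1 + x) \<le> 1 - x + x\<^sup>2"
    using assms by (simp add: field_simps power2_eq_square)
  ultimately show ?thesis by (simp add: abs_if)
qed

text \<open>The centered variable takes the value 1 - p with probability p and - p with probability
  1 - p, so the linear terms cancel. The error keeps the factor \<open>p * (1 - p)\<close>, so that
  summing it over all variables gives a multiple of the variance.\<close>

lemma centered_bernoulli_char_approx:
  fixes p u :: real
  assumes p: "0 \<le> p" "p \<le> 1"
  shows "cmod ((p * iexp u + (1 - p)) * iexp (- (u * p)) - (1 - u\<^sup>2 * (p * (1 - p)) / 2))
    \<le> \<bar>u\<bar> ^ 3 * (p * (1 - p)) / 6"
proof -
  define q where "q = 1 - p"
  define e where "e x = iexp x - (1 + \<i> * of_real x - of_real (x\<^sup>2 / 2))" for x :: real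
  have e: "cmod (e x) \<le> \<bar>x\<bar> ^ 3 / 6" for x
    using iexp_approx1[of x 2]
    by (simp add: e_def eval_nat_numeral fact_reduce power_mult_distrib algebra_simps)
  have q: "0 \<le> q" "p = 1 - q" using p by (simp_all add: q_def)
  have "iexp u * iexp (- (u * p)) = iexp (u * q)"
    by (simp add: q_def algebra_simps flip: exp_add)
  then have "(p * iexp u + (1 - p)) * iexp (- (u * p)) =
      p * iexp (u * q) + q * iexp (- (u * p))"
    by (simp add: q_def algebra_simps)
  also have "\<dots> - (1 - u\<^sup>2 * (p * (1 - p)) / 2) = of_real p * e (u * q) + of_real q * e (- (u * p))"
    unfolding e_def q(2) by (simp add: power2_eq_square field_simps)
  also have "cmod \<dots> \<le> p * (\<bar>u * q\<bar> ^ 3 / 6) + q * (\<bar>- (u * p)\<bar> ^ 3 / 6)"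
    by (intro order_trans[OF norm_triangle_ineq] add_mono;
        simp only: norm_mult norm_of_real abs_of_nonneg[OF p(1)] abs_of_nonneg[OF q(1)];
        intro mult_left_mono e p(1) q(1))
  also have "\<dots> = \<bar>u\<bar> ^ 3 * (p * q) / 6 * (q\<^sup>2 + p\<^sup>2)"
    using p q(1) by (simp add: abs_mult power_mult_distrib power2_eq_square power3_eq_cube algebra_simps)
  also have "\<dots> \<le> \<bar>u\<bar> ^ 3 * (p * q) / 6 * 1"
  proof (rule mult_left_mono)
    have "(q + p)\<^sup>2 = q\<^sup>2 + p\<^sup>2 + 2 * (q * p)" by (simp add: power2_eq_square algebra_simps)
    moreover have "(q + p)\<^sup>2 = 1" "q * p \<ge> 0" using p q(1) by (simp_all add: q_def)
    ultimately show "q\<^sup>2 + p\<^sup>2 \<le> 1" by linarith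
  qed (use p q in auto)
  finally show ?thesis by (simp add: q_def)
qed

lemma norm_iexp_affine_le_1:
  fixes p u v :: real
  assumes "0 \<le> p" "p \<le> 1"
  shows "cmod ((p * iexp u + (1 - p)) * iexp v) \<le> 1"
proof -
  have "cmod (p * iexp u + (1 - p)) \<le> cmod (p * iexp u) + cmod (of_real (1 - p))"
    using norm_triangle_ineq[of "p * iexp u" "of_real (1 - p)"] by simp
  also have "\<dots> = 1" using assms by (simp add: norm_mult del: of_real_diff)
  finally show ?thesis by (simp add: norm_mult)
qed

text \<open>Each centered factor is compared with a Gaussian factor of the same variance; all
  factors have modulus at most 1, so the products differ by at most the sum of the differences. The
  explicit bound leaves only growth of \<open>v\<close> to be checked.\<close>

lemma poisson_binomial_char_approx:
  fixes p :: "nat \<Rightarrow> real" and t :: real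
  assumes p: "\<And>i. i < N \<Longrightarrow> 0 \<le> p i \<and> p i \<le> 1"
  defines "v \<equiv> \<Sum>i<N. p i * (1 - p i)"
  assumes v: "v > 0"
  shows "cmod ((\<Prod>i<N. p i * iexp (t / sqrt v) + (1 - p i)) * iexp (- (t / sqrt v * (\<Sum>i<N. p i)))
      - exp (- t\<^sup>2 / 2)) \<le> \<bar>t\<bar> ^ 3 / (6 * sqrt v) + t ^ 4 / (4 * v)"
proof -
  define u where "u = t / sqrt v"
  define d where "d i = p i * (1 - p i)" for i
  have u2: "u\<^sup>2 * v = t\<^sup>2" using v by (simp add: u_def power_divide)
  have sv: "sqrt v > 0" using v by simp
  have d: "0 \<le> d i" "d i \<le> 1" if "i < N" for i
    using p[OF that] by (auto simp: d_def intro: mult_le_one)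
  let ?z = "\<lambda>i. (p i * iexp u + (1 - p i)) * iexp (- (u * p i))"
  let ?w = "\<lambda>i. complex_of_real (exp (- (u\<^sup>2 * d i / 2)))"
  have zw: "cmod (?z i - ?w i) \<le> \<bar>u\<bar> ^ 3 / 6 * d i + u ^ 4 / 4 * d i" if i: "i < N" for i
  proof -
    have "cmod (?z i - ?w i) \<le> cmod (?z i - (1 - u\<^sup>2 * (p i * (1 - p i)) / 2))
        + cmod ((1 - u\<^sup>2 * (p i * (1 - p i)) / 2) - ?w i)"
      using dist_triangle[of "?z i" "?w i" "complex_of_real (1 - u\<^sup>2 * (p i * (1 - p i)) / 2)"]
      by (simp only: dist_norm)
    also have "cmod ((1 - u\<^sup>2 * (p i * (1 - p i)) / 2) - ?w i) =
        cmod (of_real ((1 - u\<^sup>2 * d i / 2) - exp (- (u\<^sup>2 * d i / 2))))"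
      by (simp add: d_def)
    also have "\<dots> = \<bar>exp (- (u\<^sup>2 * d i / 2)) - (1 - u\<^sup>2 * d i / 2)\<bar>"
      by (simp only: norm_of_real abs_minus_commute)
    also have "\<dots> \<le> (u\<^sup>2 * d i / 2)\<^sup>2" using d[OF i] by (intro exp_minus_linear_approx) auto
    also have "\<dots> = u ^ 4 / 4 * (d i * d i)" by (simp add: power2_eq_square eval_nat_numeral)
    also have "\<dots> \<le> u ^ 4 / 4 * (d i * 1)" using d[OF i] by (intro mult_left_mono) auto
    finally show ?thesis
      using centered_bernoulli_char_approx[of "p i" u] p[OF i] by (simp add: d_def)
  qed
  have "(\<Prod>i<N. ?z i) = (\<Prod>i<N. p i * iexp u + (1 - p i)) * iexp (- (u * (\<Sum>i<N. p i)))"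
    by (simp add: prod.distrib exp_sum[symmetric] sum_distrib_left sum_negf)
  moreover have "(\<Prod>i<N. ?w i) = exp (- t\<^sup>2 / 2)"
  proof -
    have "(\<Prod>i<N. ?w i) = of_real (exp (\<Sum>i<N. - (u\<^sup>2 * d i / 2)))" by (simp add: exp_sum)
    also have "(\<Sum>i<N. - (u\<^sup>2 * d i / 2)) = - (u\<^sup>2 * v / 2)"
      by (simp add: v_def d_def sum_negf sum_distrib_left sum_divide_distrib)
    finally show ?thesis by (simp add: u2)
  qed
  moreover have "cmod ((\<Prod>i<N. ?z i) - (\<Prod>i<N. ?w i)) \<le> (\<Sum>i<N. cmod (?z i - ?w i))"
    using p d by (intro norm_prod_diff norm_iexp_affine_le_1) auto
  moreover have "\<dots> \<le> (\<Sum>i<N. \<bar>u\<bar> ^ 3 / 6 * d i + u ^ 4 / 4 * d i)"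
    using zw by (intro sum_mono) auto
  moreover have "\<dots> = \<bar>u\<bar> ^ 3 / 6 * v + u ^ 4 / 4 * v"
    by (simp add: v_def d_def sum.distrib sum_distrib_left)
  moreover have "\<bar>u\<bar> ^ 3 / 6 * v = \<bar>t\<bar> ^ 3 / (6 * sqrt v)"
  proof -
    have "v = sqrt v * sqrt v" using v by simp
    then show ?thesis using sv by (simp add: u_def power3_eq_cube field_simps)
  qed
  moreover have "u ^ 4 / 4 * v = t ^ 4 / (4 * v)"
  proof -
    have "u ^ 4 * v * v = t ^ 4" using u2 by (metis (no_types, lifting) mult.assoc mult.commute
      numeral_Bit0 power_add power2_eq_square power_mult_distrib)
    then show ?thesis using v by (simp add: field_simps)
  qed
  ultimately show ?thesis by (simp add: u_def)
qed

section \<open>From characteristic functions to the limit law\<close>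

text \<open>Levy's continuity theorem concerns Borel measures, while a pmf lives on the discrete
  sigma-algebra; the identity map transfers it and preserves the distribution function.\<close>

lemma weak_conv_m_pmf_of_char:
  fixes M :: "nat \<Rightarrow> real pmf"
  assumes M': "real_distribution M'"
    and lim: "\<And>t. (\<lambda>n. measure_pmf.expectation (M n) (\<lambda>x. iexp (t * x))) \<longlonglongrightarrow> char M' t"
  shows "weak_conv_m (\<lambda>n. measure_pmf (M n)) M'"
proof -
  let ?D = "\<lambda>n. distr (measure_pmf (M n)) borel (\<lambda>x. x)"
  have "weak_conv_m ?D M'"
  proof (rule levy_continuity[OF _ M'])
    show "real_distribution (?D n)" for n
      by (rule prob_space.real_distribution_distr[OF prob_space_measure_pmf]) simp
    show "(\<lambda>n. char (?D n) t) \<longlonglongrightarrow> char M' t" for t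
      using lim[of t] by (simp add: char_def integral_distr)
  qed
  moreover have "cdf (?D n) = cdf (measure_pmf (M n))" for n
    by (rule ext) (simp add: cdf_def measure_distr)
  ultimately show ?thesis by (simp add: weak_conv_m_def)
qed

text \<open>The characteristic function is the generating polynomial at \<open>iexp u\<close>
  divided by its value at 1, which factors into those of Bernoulli variables with parameters
  \<open>1 / (1 + a i)\<close>; mean and variance in these parameters come from the derivatives at
  1.\<close>

lemma xi_standardized_char_approx:
  fixes t :: real
  assumes c: "c > 0" and m: "m > 0" and V: "V_xi c m n > 0"
  shows "cmod (measure_pmf.expectation
      (map_pmf (\<lambda>x. (x - E_xi c m n) / sqrt (V_xi c m n)) (xi_pmf c m n)) (\<lambda>x. iexp (t * x))
      - exp (- t\<^sup>2 / 2)) \<le> \<bar>t\<bar> ^ 3 / (6 * sqrt (V_xi c m n)) + t ^ 4 / (4 * V_xi c m n)"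
proof -
  obtain a :: "nat \<Rightarrow> real" where a: "\<And>i. i < n \<Longrightarrow> a i > 0"
      "Bsum c m n (monom 1) = (\<Prod>i<n. [:a i, 1:])"
    using Bsum_monom_splits[OF c m] by blast
  define p where "p i = 1 / (1 + a i)" for i
  define D where "D = Bsum c m n (\<lambda>_. 1 :: real)"
  have D: "D > 0" using Bsum_1_pos[OF c m] by (simp add: D_def)
  have p: "0 \<le> p i \<and> p i \<le> 1" if "i < n" for i using a(1)[OF that] by (simp add: p_def)
  have D_poly: "poly (\<Prod>i<n. [:a i, 1:]) 1 = D"
    using poly_Bsum_monom[of c m n "1::real"] by (simp add: a(2) D_def)
  then have D_prod: "D = (\<Prod>i<n. 1 + a i)" by (simp add: poly_prod add.commute)
  have S1: "Bsum c m n real = D * (\<Sum>i<n. p i)"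
    using poly_pderiv_prod_linear(1)[of n a, OF a(1)]
    unfolding a(2)[symmetric] poly_pderiv_Bsum_monom D_poly[symmetric] p_def by simp
  have S2: "Bsum c m n (\<lambda>k. real k * (real k - 1)) = D * ((\<Sum>i<n. p i)\<^sup>2 - (\<Sum>i<n. (p i)\<^sup>2))"
    using poly_pderiv_prod_linear(2)[of n a, OF a(1)]
    unfolding a(2)[symmetric] poly_pderiv2_Bsum_monom D_poly[symmetric] p_def by simp
  have E: "E_xi c m n = (\<Sum>i<n. p i)"
    using D by (simp add: E_xi_eq[OF c m] S1 D_def[symmetric])
  have "Bsum c m n (\<lambda>k. (real k)\<^sup>2) = Bsum c m n (\<lambda>k. real k * (real k - 1) + real k)"
    by (intro Bsum_cong) (simp add: power2_eq_square algebra_simps)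
  also have "\<dots> = D * ((\<Sum>i<n. p i)\<^sup>2 - (\<Sum>i<n. (p i)\<^sup>2)) + D * (\<Sum>i<n. p i)"
    by (simp only: Bsum_add S1 S2)
  finally have "V_xi c m n = (\<Sum>i<n. p i) - (\<Sum>i<n. (p i)\<^sup>2)"
    using D by (simp add: V_xi_eq[OF c m] E D_def[symmetric] add_divide_distrib)
  then have Vp: "V_xi c m n = (\<Sum>i<n. p i * (1 - p i))"
    by (simp add: sum_subtractf[symmetric] power2_eq_square algebra_simps)
  define u where "u = t / sqrt (V_xi c m n)"
  have "measure_pmf.expectation
      (map_pmf (\<lambda>x. (x - E_xi c m n) / sqrt (V_xi c m n)) (xi_pmf c m n)) (\<lambda>x. iexp (t * x)) =
    measure_pmf.expectation (pmf_of_set (Bpart c m n))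
      (\<lambda>\<pi>. (\<lambda>k. iexp (- (u * E_xi c m n)) * iexp u ^ k) (nonzero_blocks \<pi>))"
    unfolding xi_pmf_def map_pmf_comp integral_map_pmf
    by (intro Bochner_Integration.integral_cong refl)
      (simp add: u_def diff_divide_distrib right_diff_distrib exp_of_nat_mult[symmetric]
        algebra_simps flip: exp_add)
  also have "\<dots> = iexp (- (u * E_xi c m n)) * Bsum c m n (\<lambda>k. iexp u ^ k) / of_real D"
    using expectation_pmf_of_set_Bpart[OF c m, of n "\<lambda>k. iexp (- (u * E_xi c m n)) * iexp u ^ k"]
    by (simp only: Bsum_cmult D_def)
  also have "\<dots> = (\<Prod>i<n. iexp u + a i) / of_real D * iexp (- (u * E_xi c m n))"
    unfolding Bsum_power_complex[OF a(2)] by simp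
  also have "(\<Prod>i<n. iexp u + a i) / of_real D = (\<Prod>i<n. (iexp u + a i) / of_real (1 + a i))"
    unfolding D_prod of_real_prod by (rule prod_dividef[symmetric])
  also have "(\<Prod>i<n. (iexp u + a i) / of_real (1 + a i)) = (\<Prod>i<n. p i * iexp u + (1 - p i))"
  proof (intro prod.cong refl)
    fix i assume "i \<in> {..<n}"
    then have a1: "1 + a i > 0" using a(1)[of i] by simp
    then have "1 - p i = a i / (1 + a i)" by (simp add: p_def field_simps)
    then have "1 - complex_of_real (p i) = of_real (a i / (1 + a i))" by (metis of_real_1 of_real_diff)
    then show "(iexp u + a i) / of_real (1 + a i) = p i * iexp u + (1 - p i)"
      by (simp add: p_def add_divide_distrib)
  qed
  finally show ?thesis
    using poisson_binomial_char_approx[of n p t, OF p] V unfolding Vp[symmetric] E[symmetric]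
    by (simp add: u_def)
qed

theorem theorem7:
  fixes c m :: nat
  assumes "c > 0" and "m > 0"
  shows "weak_conv_m
           (\<lambda>n. measure_pmf (map_pmf (\<lambda>x. (x - E_xi c m (Suc n)) / sqrt (V_xi c m (Suc n)))
                                      (xi_pmf c m (Suc n))))
           std_normal_distribution"
proof (rule weak_conv_m_pmf_of_char[OF real_dist_normal_dist])
  fix t :: real
  let ?V = "\<lambda>n. V_xi c m (Suc n)"
  let ?\<phi> = "\<lambda>n. measure_pmf.expectation
    (map_pmf (\<lambda>x. (x - E_xi c m (Suc n)) / sqrt (?V n)) (xi_pmf c m (Suc n))) (\<lambda>x. iexp (t * x))"
  have V: "filterlim ?V at_top sequentially"
    using V_xi_at_top[OF assms] by (rule filterlim_compose[OF _ filterlim_Suc])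
  have sqrtV: "filterlim (\<lambda>n. sqrt (?V n)) at_top sequentially"
    using sqrt_at_top V by (rule filterlim_compose)
  have "(\<lambda>n. \<bar>t\<bar> ^ 3 / 6 * inverse (sqrt (?V n)) + t ^ 4 / 4 * inverse (?V n)) \<longlonglongrightarrow>
      \<bar>t\<bar> ^ 3 / 6 * 0 + t ^ 4 / 4 * 0"
    by (intro tendsto_intros filterlim_compose[OF tendsto_inverse_0_at_top] V sqrtV
      tendsto_inverse_0_at_top)
  moreover have "x / (6 * s) = x / 6 * inverse s" "x / (4 * s) = x / 4 * inverse s" for x s :: real
    by (simp_all add: inverse_eq_divide)
  ultimately have bound: "(\<lambda>n. \<bar>t\<bar> ^ 3 / (6 * sqrt (?V n)) + t ^ 4 / (4 * ?V n)) \<longlonglongrightarrow> 0"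
    by (simp only: mult_zero_right add_0)
  \<comment> \<open>The error bound assumes positive variance; having it from some index on suffices
    for the limit.\<close>
  have "\<forall>\<^sub>F n in sequentially. ?V n > 0"
    using V by (simp add: filterlim_at_top_dense)
  then have "\<forall>\<^sub>F n in sequentially. norm (?\<phi> n - exp (- t\<^sup>2 / 2)) \<le>
      \<bar>t\<bar> ^ 3 / (6 * sqrt (?V n)) + t ^ 4 / (4 * ?V n)"
    by (rule eventually_mono) (rule xi_standardized_char_approx[OF assms])
  then have "(\<lambda>n. ?\<phi> n - exp (- t\<^sup>2 / 2)) \<longlonglongrightarrow> 0"
    by (rule Lim_null_comparison[OF _ bound])
  then show "?\<phi> \<longlonglongrightarrow> char std_normal_distribution t"
    by (simp add: LIM_zero_iff char_std_normal_distribution)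
qed

end
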